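(* Let $H$ be an inverse semigroup with $0$. Then $H$ is isomorphic to the inverse hull of a Markov subshift (that is, to $H(S_T)$ for some Markov transition matrix $T$) if and only if (1) $H$ is combinatorial, (2) there is a set $\mathcal{O}$ of nonzero idempotents in $H$ satisfying (O1)--(O5) (as listed in the context), and (3) the language $L$ associated with $\mathcal{O}$ generates $H$ (as an inverse semigroup with $0$).
   Context: Inverse semigroups. In an inverse semigroup $H$, $s^*$ is the unique inverse of $s$, $E(H)$ is the set of idempotents, and $s\le t$ means $s=te$ for some $e\in E(H)$. $s\mathrel{\mathcal{L}}t$ iff $s^*s=t^*t$; $s\mathrel{\mathcal{R}}t$ iff $ss^*=tt^*$; $\mathcal{H}=\mathcal{L}\cap\mathcal{R}$. $H$ is combinatorial if $s\mathrel{\mathcal{H}}t$ implies $s=t$. For idempotents, $e\mathrel{\mathcal{D}}f$ iff there is $a\in H$ with $a^*a=e$, $aa^*=f$. Inverse hull of a Markov subshift. Let $B$ be a finite alphabet. A Markov transition matrix is a matrix $T=(T_{a,b})_{a,b\in B}$ with entries in $\{0,1\}$; it is always assumed that no row of $T$ is zero. The Markov subshift of $T$ is the set of infinite words $a_1a_2a_3\cdots$ over $B$ with $T_{a_i,a_{i+1}}=1$ for all $i$. $L_T$ is the set of all finite (nonempty) words occurring as subwords of elements of the subshift. $S_T=L_T\cup\{0\}$ is a semigroup with zero under $x*y=xy$ (concatenation) if $xy\in L_T$ and $x*y=0$ otherwise. For $s\in L_T$, $\theta_s$ is the partial bijection of $L_T$ with domain $\{x\in L_T: sx\in L_T\}$,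 given by $\theta_s(x)=sx$. The inverse hull $H(S_T)$ is the inverse semigroup with $0$ generated by $\{\theta_s:s\in L_T\}$ inside the inverse semigroup of partial bijections of $L_T$ (composition on the largest possible domain); $0$ is the empty map. Conditions on $\mathcal{O}$. For a set $\mathcal{O}$ of nonzero idempotents of $H$ let $\mathcal{O}^{\uparrow}=\{\alpha\in E(H):\alpha\ge e\text{ for some }e\in\mathcal{O}\}$. The conditions are: (O1) the elements of $\mathcal{O}$ are mutually orthogonal (distinct elements have product $0$); (O2) every idempotent in $H$ is comparable (in $\le$) to some element of $\mathcal{O}$; (O3) both $\mathcal{O}^{\uparrow}\cup\{0\}$ and $(\mathcal{O}^{\uparrow}-\mathcal{O})\cup\{0\}$ are closed under multiplication; (O4) elements of $\mathcal{O}^{\uparrow}-\mathcal{O}$ are uniquely determined by the set of idempotents in $\mathcal{O}$ that they lie above: if $\alpha,\beta\in\mathcal{O}^{\uparrow}-\mathcal{O}$ and $\{e\in\mathcal{O}:e\le\alpha\}=\{e\in\mathcal{O}:e\le\beta\}$ then $\alpha=\beta$; (O5) for each $e\in\mathcal{O}$, the $\mathcal{D}$-class of $e$ contains at most one element of $\mathcal{O}^{\uparrow}-\mathcal{O}$. The language associated with $\mathcal{O}$ is $L=\{a_1a_2\cdots a_n\ne 0: n\ge 1,\ a_i\in A\}\subseteq H$, where $A=\{a\in H: a^*a\in\mathcal{O}^{\uparrow}-\mathcal{O}\text{ and }aa^*\in\mathcal{O}\}$. "$L$ generates $H$ as an inverse semigroup with $0$" means that every nonzero element of $H$ is a product of elements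 of $L$ and their inverses.
   Formalization: For a finite (nonempty) alphabet B the set A in the definition of L is also required to be finite, since the infinite polycyclic monoid satisfies (1)–(3) but is not finitely generated; (1)–(3) as stated are shown equivalent to being a hull over a nonempty, possibly infinite, alphabet. *)

theory Defs
  imports Main
begin

section \<open>Inverse semigroups with zero\<close>

record 'a zero_semigroup =
  carrier :: "'a set"
  mult :: "'a \<Rightarrow> 'a \<Rightarrow> 'a" (infixl "\<otimes>\<index>" 70)
  zero :: 'a ("\<zero>\<index>")

definition is_inverse :: "('a, 'm) zero_semigroup_scheme \<Rightarrow> 'a \<Rightarrow> 'a \<Rightarrow> bool" where
  "is_inverse H s t \<longleftrightarrow> t \<in> carrier H \<and>
     s \<otimes>\<^bsub>H\<^esub> t \<otimes>\<^bsub>H\<^esub> s = s \<and> t \<otimes>\<^bsub>H\<^esub> s \<otimes>\<^bsub>H\<^esub> t = t"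

locale inverse_semigroup_zero =
  fixes H :: "('a, 'm) zero_semigroup_scheme" (structure)
  assumes mult_closed: "\<lbrakk>x \<in> carrier H; y \<in> carrier H\<rbrakk> \<Longrightarrow> x \<otimes> y \<in> carrier H"
    and mult_assoc: "\<lbrakk>x \<in> carrier H; y \<in> carrier H; z \<in> carrier H\<rbrakk>
      \<Longrightarrow> (x \<otimes> y) \<otimes> z = x \<otimes> (y \<otimes> z)"
    and ex1_inverse: "s \<in> carrier H \<Longrightarrow> \<exists>!t. is_inverse H s t"
    and zero_closed: "\<zero> \<in> carrier H"
    and zero_left: "x \<in> carrier H \<Longrightarrow> \<zero> \<otimes> x = \<zero>"
    and zero_right: "x \<in> carrier H \<Longrightarrow> x \<otimes> \<zero> = \<zero>"

definition star :: "('a, 'm) zero_semigroup_scheme \<Rightarrow> 'a \<Rightarrow> 'a" where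
  "star H s = (THE t. is_inverse H s t)"

definition idems :: "('a, 'm) zero_semigroup_scheme \<Rightarrow> 'a set" where
  "idems H = {e \<in> carrier H. e \<otimes>\<^bsub>H\<^esub> e = e}"

definition natural_le :: "('a, 'm) zero_semigroup_scheme \<Rightarrow> 'a \<Rightarrow> 'a \<Rightarrow> bool" where
  "natural_le H s t \<longleftrightarrow> (\<exists>e \<in> idems H. s = t \<otimes>\<^bsub>H\<^esub> e)"

definition green_L :: "('a, 'm) zero_semigroup_scheme \<Rightarrow> 'a \<Rightarrow> 'a \<Rightarrow> bool" where
  "green_L H s t \<longleftrightarrow> star H s \<otimes>\<^bsub>H\<^esub> s = star H t \<otimes>\<^bsub>H\<^esub> t"

definition green_R :: "('a, 'm) zero_semigroup_scheme \<Rightarrow> 'a \<Rightarrow> 'a \<Rightarrow> bool" where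
  "green_R H s t \<longleftrightarrow> s \<otimes>\<^bsub>H\<^esub> star H s = t \<otimes>\<^bsub>H\<^esub> star H t"

definition green_H :: "('a, 'm) zero_semigroup_scheme \<Rightarrow> 'a \<Rightarrow> 'a \<Rightarrow> bool" where
  "green_H H s t \<longleftrightarrow> green_L H s t \<and> green_R H s t"

text \<open>Used for idempotents only.\<close>

definition green_D :: "('a, 'm) zero_semigroup_scheme \<Rightarrow> 'a \<Rightarrow> 'a \<Rightarrow> bool" where
  "green_D H e f \<longleftrightarrow>
     (\<exists>a \<in> carrier H. star H a \<otimes>\<^bsub>H\<^esub> a = e \<and> a \<otimes>\<^bsub>H\<^esub> star H a = f)"

definition combinatorial :: "('a, 'm) zero_semigroup_scheme \<Rightarrow> bool" where
  "combinatorial H \<longleftrightarrow>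
     (\<forall>s \<in> carrier H. \<forall>t \<in> carrier H. green_H H s t \<longrightarrow> s = t)"

text \<open>Multiplicativity and bijectivity already force \<^term>\<open>\<phi>\<close> to respect zero and inverses.\<close>

definition isomorphic ::
    "('a, 'm) zero_semigroup_scheme \<Rightarrow> ('b, 'n) zero_semigroup_scheme \<Rightarrow> bool" where
  "isomorphic G H \<longleftrightarrow> (\<exists>\<phi>. bij_betw \<phi> (carrier G) (carrier H) \<and>
     (\<forall>x \<in> carrier G. \<forall>y \<in> carrier G. \<phi> (x \<otimes>\<^bsub>G\<^esub> y) = \<phi> x \<otimes>\<^bsub>H\<^esub> \<phi> y))"

text \<open>All products of one or more elements of \<^term>\<open>X\<close>.\<close>

inductive_set products :: "('a, 'm) zero_semigroup_scheme \<Rightarrow> 'a set \<Rightarrow> 'a set"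
  for H :: "('a, 'm) zero_semigroup_scheme" and X :: "'a set" where
  single: "x \<in> X \<Longrightarrow> x \<in> products H X"
| step: "\<lbrakk>x \<in> X; y \<in> products H X\<rbrakk> \<Longrightarrow> x \<otimes>\<^bsub>H\<^esub> y \<in> products H X"

text \<open>Carrier of the inverse subsemigroup with zero of \<^term>\<open>H\<close> generated by \<^term>\<open>X\<close>.\<close>

definition generated :: "('a, 'm) zero_semigroup_scheme \<Rightarrow> 'a set \<Rightarrow> 'a set" where
  "generated H X = insert \<zero>\<^bsub>H\<^esub> (products H (X \<union> star H ` X))"

definition generates :: "('a, 'm) zero_semigroup_scheme \<Rightarrow> 'a set \<Rightarrow> bool" where
  "generates H X \<longleftrightarrow> (\<forall>h \<in> carrier H. h \<noteq> \<zero>\<^bsub>H\<^esub> \<longrightarrow> h \<in> products H (X \<union> star H ` X))"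


section \<open>The inverse hull of a Markov subshift\<close>

text \<open>
  The alphabet is a set \<^term>\<open>B\<close>, always nonempty; its finiteness is stated separately where it
  is wanted.  Values of \<^term>\<open>T\<close> outside \<^term>\<open>B\<close> are irrelevant.
\<close>

definition transition_matrix :: "'b set \<Rightarrow> ('b \<Rightarrow> 'b \<Rightarrow> nat) \<Rightarrow> bool" where
  "transition_matrix B T \<longleftrightarrow> B \<noteq> {} \<and>
     (\<forall>a \<in> B. \<forall>b \<in> B. T a b \<in> {0, 1}) \<and>
     (\<forall>a \<in> B. \<exists>b \<in> B. T a b \<noteq> 0)"

definition subshift :: "'b set \<Rightarrow> ('b \<Rightarrow> 'b \<Rightarrow> nat) \<Rightarrow> (nat \<Rightarrow> 'b) set" where
  "subshift B T = {a. \<forall>i. a i \<in> B \<and> T (a i) (a (Suc i)) = 1}"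

definition lang :: "'b set \<Rightarrow> ('b \<Rightarrow> 'b \<Rightarrow> nat) \<Rightarrow> 'b list set" where
  "lang B T = {w. w \<noteq> [] \<and> (\<exists>a \<in> subshift B T. \<exists>i. w = map a [i ..< i + length w])}"

text \<open>
  Partial maps are functions into \<^typ>\<open>'c option\<close>; \<^term>\<open>f \<circ>\<^sub>m g\<close> applies \<^term>\<open>g\<close> first and is
  defined on the largest possible domain.
\<close>

definition partial_bijections :: "'c set \<Rightarrow> ('c \<rightharpoonup> 'c) zero_semigroup" where
  "partial_bijections X =
     \<lparr>carrier = {f. dom f \<subseteq> X \<and> ran f \<subseteq> X \<and> inj_on f (dom f)},
      mult = (\<circ>\<^sub>m), zero = Map.empty\<rparr>"

definition theta :: "'b list set \<Rightarrow> 'b list \<Rightarrow> ('b list \<rightharpoonup> 'b list)" where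
  "theta W s = (\<lambda>x. if x \<in> W \<and> s @ x \<in> W then Some (s @ x) else None)"

definition inverse_hull ::
    "'b set \<Rightarrow> ('b \<Rightarrow> 'b \<Rightarrow> nat) \<Rightarrow> ('b list \<rightharpoonup> 'b list) zero_semigroup" where
  "inverse_hull B T =
     (let W = lang B T; I = partial_bijections W
      in I\<lparr>carrier := generated I (theta W ` W)\<rparr>)"


section \<open>Orthogonal sets of idempotents and their languages\<close>

definition up_set :: "('a, 'm) zero_semigroup_scheme \<Rightarrow> 'a set \<Rightarrow> 'a set" where
  "up_set H \<O> = {\<alpha> \<in> idems H. \<exists>e \<in> \<O>. natural_le H e \<alpha>}"

definition mult_closed_set :: "('a, 'm) zero_semigroup_scheme \<Rightarrow> 'a set \<Rightarrow> bool" where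
  "mult_closed_set H X \<longleftrightarrow> (\<forall>x \<in> X. \<forall>y \<in> X. x \<otimes>\<^bsub>H\<^esub> y \<in> X)"

definition O1 :: "('a, 'm) zero_semigroup_scheme \<Rightarrow> 'a set \<Rightarrow> bool" where
  "O1 H \<O> \<longleftrightarrow> (\<forall>e \<in> \<O>. \<forall>f \<in> \<O>. e \<noteq> f \<longrightarrow> e \<otimes>\<^bsub>H\<^esub> f = \<zero>\<^bsub>H\<^esub>)"

definition O2 :: "('a, 'm) zero_semigroup_scheme \<Rightarrow> 'a set \<Rightarrow> bool" where
  "O2 H \<O> \<longleftrightarrow> (\<forall>f \<in> idems H. \<exists>e \<in> \<O>. natural_le H f e \<or> natural_le H e f)"

definition O3 :: "('a, 'm) zero_semigroup_scheme \<Rightarrow> 'a set \<Rightarrow> bool" where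
  "O3 H \<O> \<longleftrightarrow> mult_closed_set H (up_set H \<O> \<union> {\<zero>\<^bsub>H\<^esub>}) \<and>
              mult_closed_set H ((up_set H \<O> - \<O>) \<union> {\<zero>\<^bsub>H\<^esub>})"

definition O4 :: "('a, 'm) zero_semigroup_scheme \<Rightarrow> 'a set \<Rightarrow> bool" where
  "O4 H \<O> \<longleftrightarrow> (\<forall>\<alpha> \<in> up_set H \<O> - \<O>. \<forall>\<beta> \<in> up_set H \<O> - \<O>.
     {e \<in> \<O>. natural_le H e \<alpha>} = {e \<in> \<O>. natural_le H e \<beta>} \<longrightarrow> \<alpha> = \<beta>)"

definition O5 :: "('a, 'm) zero_semigroup_scheme \<Rightarrow> 'a set \<Rightarrow> bool" where
  "O5 H \<O> \<longleftrightarrow> (\<forall>e \<in> \<O>. \<forall>\<alpha> \<in> up_set H \<O> - \<O>. \<forall>\<beta> \<in> up_set H \<O> - \<O>.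
     green_D H e \<alpha> \<and> green_D H e \<beta> \<longrightarrow> \<alpha> = \<beta>)"

definition O_conditions :: "('a, 'm) zero_semigroup_scheme \<Rightarrow> 'a set \<Rightarrow> bool" where
  "O_conditions H \<O> \<longleftrightarrow> \<O> \<subseteq> idems H - {\<zero>\<^bsub>H\<^esub>} \<and>
     O1 H \<O> \<and> O2 H \<O> \<and> O3 H \<O> \<and> O4 H \<O> \<and> O5 H \<O>"

text \<open>
  The set below is the alphabet of the associated language.  The conditions above do not make it
  finite: the polycyclic inverse monoid on infinitely many generators \<^term>\<open>b\<close> satisfies all of
  them, with \<^term>\<open>\<O>\<close> the set of the idempotents \<open>b b\<^sup>*\<close> and the generators as alphabet.
\<close>

definition assoc_alphabet :: "('a, 'm) zero_semigroup_scheme \<Rightarrow> 'a set \<Rightarrow> 'a set" where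
  "assoc_alphabet H \<O> = {a \<in> carrier H.
     star H a \<otimes>\<^bsub>H\<^esub> a \<in> up_set H \<O> - \<O> \<and> a \<otimes>\<^bsub>H\<^esub> star H a \<in> \<O>}"

definition assoc_language :: "('a, 'm) zero_semigroup_scheme \<Rightarrow> 'a set \<Rightarrow> 'a set" where
  "assoc_language H \<O> = products H (assoc_alphabet H \<O>) - {\<zero>\<^bsub>H\<^esub>}"

end

(*
  The nonzero elements of the inverse hull are the partial maps ts -> us, where s runs through the
  words whose first letter lies in a fixed set R; an idempotent is thus determined by a word t and
  a set R, and the idempotents theta_b theta_b^* of the letters b satisfy (O1)-(O5).

  Conversely, (O1)-(O3) give alpha a = 0 or alpha a = a for alpha in Q = O^up - O and every letter a, and
  (O5) together with combinatoriality gives a^* b = 0 for distinct letters.  Hence every nonzero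
  element of H has the form u gamma t^* with words u, t and gamma in Q, and the nonzero products of
  letters are the words of a Markov subshift.  H acts on these words by germs at the filters
  {alpha in Q : alpha b = b}, letters acting by left concatenation.  The action is faithful on
  idempotents by (O4), hence faithful because H is combinatorial, and since the letters generate H
  its image is the inverse hull.
*)
theory Submission
  imports Defs
begin

section \<open>Inverse semigroups\<close>

text \<open>Two equivalences are stated because (O1)-(O5) do not bound the number of letters. The
  first demands a finite alphabet on both sides and numbers the letters; the second drops finiteness
  and takes the letters of \<open>H\<close> themselves as the alphabet.

  The obstacle in the converse is the choice of the action. Left multiplication on the language
  gives the wrong one: for a letter \<open>a\<close> of \<open>H\<close> the idempotent
  \<open>a a\<^sup>\<star>\<close> satisfies \<open>a a\<^sup>\<star> a = a\<close> and would fix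
  the one-letter word, whereas in the hull it is the identity on the words that properly extend this
  word. So a word \<open>v @ [b]\<close> is read as the (possibly empty) prefix \<open>v\<close>
  near the point \<open>b\<close>: prefixes are compared after restriction to some idempotent of
  \<open>Q\<close> that fixes \<open>b\<close>, and no member of \<open>Q\<close> lies below
  \<open>a a\<^sup>\<star>\<close>, which keeps the one-letter word out of its domain. Faithfulness
  on idempotents then comes from the shortest words of a domain, which reveal the prefix and the
  admissible letters.\<close>

context inverse_semigroup_zero
begin

abbreviation inv_op :: "'a \<Rightarrow> 'a" ("_\<^sup>\<star>" [1000] 1000)
  where "s\<^sup>\<star> \<equiv> star H s"

declare mult_closed [simp, intro] zero_closed [simp, intro] zero_left [simp] zero_right [simp]

lemma star_is_inverse: "s \<in> carrier H \<Longrightarrow> is_inverse H s (s\<^sup>\<star>)"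
  unfolding star_def by (rule theI') (rule ex1_inverse)

lemma star_unique: "\<lbrakk>s \<in> carrier H; is_inverse H s t\<rbrakk> \<Longrightarrow> s\<^sup>\<star> = t"
  using ex1_inverse star_is_inverse by blast

lemma star_closed [simp, intro]: "s \<in> carrier H \<Longrightarrow> s\<^sup>\<star> \<in> carrier H"
  using star_is_inverse unfolding is_inverse_def by blast

lemma mult_star_mult [simp]: "s \<in> carrier H \<Longrightarrow> s \<otimes> (s\<^sup>\<star> \<otimes> s) = s"
  and star_mult_star [simp]: "s \<in> carrier H \<Longrightarrow> s\<^sup>\<star> \<otimes> (s \<otimes> s\<^sup>\<star>) = s\<^sup>\<star>"
  using star_is_inverse[of s] by (auto simp: is_inverse_def mult_assoc)

text \<open>Right-nested versions, so that \<open>simp\<close> with \<open>mult_assoc\<close> also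
  cancels in the middle of a longer product.\<close>

lemma mult_star_mult_assoc [simp]:
  "\<lbrakk>s \<in> carrier H; x \<in> carrier H\<rbrakk> \<Longrightarrow> s \<otimes> (s\<^sup>\<star> \<otimes> (s \<otimes> x)) = s \<otimes> x"
  "\<lbrakk>s \<in> carrier H; x \<in> carrier H\<rbrakk> \<Longrightarrow> s\<^sup>\<star> \<otimes> (s \<otimes> (s\<^sup>\<star> \<otimes> x)) = s\<^sup>\<star> \<otimes> x"
  using mult_star_mult[of s] star_mult_star[of s] by (metis mult_assoc mult_closed star_closed)+

lemma star_star [simp]: "s \<in> carrier H \<Longrightarrow> s\<^sup>\<star>\<^sup>\<star> = s"
  by (rule star_unique) (auto simp: is_inverse_def mult_assoc)

lemma idems_closed [simp, intro]: "e \<in> idems H \<Longrightarrow> e \<in> carrier H"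
  and idems_mult_self: "e \<in> idems H \<Longrightarrow> e \<otimes> e = e"
  by (auto simp: idems_def)

lemma idemsI: "\<lbrakk>e \<in> carrier H; e \<otimes> e = e\<rbrakk> \<Longrightarrow> e \<in> idems H"
  by (simp add: idems_def del: idems_closed)

lemma idems_mult_self_assoc:
  "\<lbrakk>e \<in> idems H; x \<in> carrier H\<rbrakk> \<Longrightarrow> e \<otimes> (e \<otimes> x) = e \<otimes> x"
  by (metis idems_closed idems_mult_self mult_assoc)

lemma idems_star: "e \<in> idems H \<Longrightarrow> e\<^sup>\<star> = e"
  by (rule star_unique) (simp_all add: is_inverse_def idems_mult_self)

lemma zero_idem [simp, intro]: "\<zero> \<in> idems H"
  by (rule idemsI) simp_all

lemma zero_star [simp]: "\<zero>\<^sup>\<star> = \<zero>"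
  by (rule idems_star) simp

lemma star_mult_idem [simp, intro]: "s \<in> carrier H \<Longrightarrow> s\<^sup>\<star> \<otimes> s \<in> idems H"
  and mult_star_idem [simp, intro]: "s \<in> carrier H \<Longrightarrow> s \<otimes> s\<^sup>\<star> \<in> idems H"
  by (rule idemsI; simp add: mult_assoc)+

text \<open>For idempotents \<open>e\<close>, \<open>f\<close> the element \<open>f (ef)\<^sup>\<star> e\<close> is an idempotent inverse of \<open>ef\<close>.\<close>

lemma idems_mult: assumes "e \<in> idems H" "f \<in> idems H" shows "e \<otimes> f \<in> idems H"
proof -
  note [simp] = idems_mult_self[OF assms(1)] idems_mult_self[OF assms(2)]
    idems_mult_self_assoc[OF assms(1)] idems_mult_self_assoc[OF assms(2)]
  have C [simp]: "e \<in> carrier H" "f \<in> carrier H" using assms by auto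
  define x where "x = (e \<otimes> f)\<^sup>\<star>"
  have x [simp]: "x \<in> carrier H" by (simp add: x_def)
  have 1: "e \<otimes> (f \<otimes> (x \<otimes> (e \<otimes> f))) = e \<otimes> f" and 2: "x \<otimes> (e \<otimes> (f \<otimes> x)) = x"
    using mult_star_mult[of "e \<otimes> f"] star_mult_star[of "e \<otimes> f"] unfolding x_def[symmetric]
    by (simp_all add: mult_assoc)
  have 3: "x \<otimes> (e \<otimes> (f \<otimes> (x \<otimes> e))) = x \<otimes> e"
    using 2 by (metis C mult_assoc mult_closed x)
  have "is_inverse H (e \<otimes> f) (f \<otimes> (x \<otimes> e))"
    using 1 3 by (simp add: is_inverse_def mult_assoc)
  from star_unique[OF mult_closed[OF C] this] have fxe: "x = f \<otimes> (x \<otimes> e)"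
    unfolding x_def[symmetric] .
  have "x \<otimes> x = (f \<otimes> (x \<otimes> e)) \<otimes> (f \<otimes> (x \<otimes> e))"
    by (rule arg_cong2[of _ _ _ _ "(\<otimes>)"]) (rule fxe)+
  also have "\<dots> = f \<otimes> (x \<otimes> e)" using 3 by (simp add: mult_assoc)
  finally have "x \<in> idems H" unfolding fxe[symmetric] by (intro idemsI x)
  then have "e \<otimes> f = x" using idems_star star_star[of "e \<otimes> f"] by (simp add: x_def)
  with \<open>x \<in> idems H\<close> show ?thesis by simp
qed

text \<open>Both products are idempotent by \<open>idems_mult\<close>, so
  \<open>e \<otimes> f\<close> is its own inverse; \<open>f \<otimes> e\<close> is an inverse of it
  too, and inverses are unique.\<close>

lemma idems_commute: assumes "e \<in> idems H" "f \<in> idems H" shows "e \<otimes> f = f \<otimes> e"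
proof -
  note [simp] = idems_mult_self[OF assms(1)] idems_mult_self[OF assms(2)]
    idems_mult_self_assoc[OF assms(1)] idems_mult_self_assoc[OF assms(2)]
  have C [simp]: "e \<in> carrier H" "f \<in> carrier H" using assms by auto
  have ef: "e \<otimes> f \<in> idems H" "f \<otimes> e \<in> idems H" using assms by (auto intro: idems_mult)
  have "is_inverse H (e \<otimes> f) (f \<otimes> e)"
    using idems_mult_self[OF ef(1)] idems_mult_self[OF ef(2)] by (simp add: is_inverse_def mult_assoc)
  then show ?thesis using star_unique[of "e \<otimes> f"] idems_star[OF ef(1)] by simp
qed

lemma star_mult: assumes [simp]: "s \<in> carrier H" "t \<in> carrier H" shows "(s \<otimes> t)\<^sup>\<star> = t\<^sup>\<star> \<otimes> s\<^sup>\<star>"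
proof (rule star_unique)
  have c: "(t \<otimes> t\<^sup>\<star>) \<otimes> (s\<^sup>\<star> \<otimes> s) = (s\<^sup>\<star> \<otimes> s) \<otimes> (t \<otimes> t\<^sup>\<star>)"
    by (rule idems_commute) auto
  have "(s \<otimes> t) \<otimes> (t\<^sup>\<star> \<otimes> s\<^sup>\<star>) \<otimes> (s \<otimes> t) = s \<otimes> ((t \<otimes> t\<^sup>\<star>) \<otimes> (s\<^sup>\<star> \<otimes> s)) \<otimes> t"
    by (simp add: mult_assoc)
  also have "\<dots> = s \<otimes> t" unfolding c by (simp add: mult_assoc)
  finally have 1: "(s \<otimes> t) \<otimes> (t\<^sup>\<star> \<otimes> s\<^sup>\<star>) \<otimes> (s \<otimes> t) = s \<otimes> t" .
  have "(t\<^sup>\<star> \<otimes> s\<^sup>\<star>) \<otimes> (s \<otimes> t) \<otimes> (t\<^sup>\<star> \<otimes> s\<^sup>\<star>) = t\<^sup>\<star> \<otimes> ((s\<^sup>\<star> \<otimes> s) \<otimes> (t \<otimes> t\<^sup>\<star>)) \<otimes> s\<^sup>\<star>"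
    by (simp add: mult_assoc)
  also have "\<dots> = t\<^sup>\<star> \<otimes> s\<^sup>\<star>" unfolding c[symmetric] by (simp add: mult_assoc)
  finally show "is_inverse H (s \<otimes> t) (t\<^sup>\<star> \<otimes> s\<^sup>\<star>)" using 1 by (simp add: is_inverse_def)
qed simp

lemma natural_le_idems:
  assumes "e \<in> idems H" "f \<in> idems H"
  shows "natural_le H e f \<longleftrightarrow> f \<otimes> e = e"
  unfolding natural_le_def using assms idems_mult_self_assoc[of f] by (metis idems_closed)

text \<open>\<open>e\<close> commutes with \<open>x \<otimes> x\<^sup>\<star>\<close>, so
  \<open>e \<otimes> x\<close> is \<open>x\<close> times the left side of the hypothesis. This turns
  an equality of domain idempotents into absorption, which is what inverting and composing germs
  requires.\<close>

lemma idem_absorb: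
  assumes "e \<in> idems H" "x \<in> carrier H" "x\<^sup>\<star> \<otimes> (e \<otimes> x) = x\<^sup>\<star> \<otimes> x"
  shows "e \<otimes> x = x"
proof -
  have "e \<otimes> x = (e \<otimes> (x \<otimes> x\<^sup>\<star>)) \<otimes> x" using assms by (simp add: mult_assoc)
  also have "\<dots> = x \<otimes> (x\<^sup>\<star> \<otimes> (e \<otimes> x))"
    using assms idems_commute[of e "x \<otimes> x\<^sup>\<star>"] by (simp add: mult_assoc)
  finally show ?thesis using assms by simp
qed

lemma star_mult_eq_zero_iff: "x \<in> carrier H \<Longrightarrow> x\<^sup>\<star> \<otimes> x = \<zero> \<longleftrightarrow> x = \<zero>"
  by (metis mult_star_mult star_closed zero_right)

lemma products_closed: "X \<subseteq> carrier H \<Longrightarrow> products H X \<subseteq> carrier H"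
proof
  fix x assume X: "X \<subseteq> carrier H" and "x \<in> products H X"
  from this(2) show "x \<in> carrier H" using X by (induction rule: products.induct) auto
qed

lemma products_mult:
  assumes "X \<subseteq> carrier H" "x \<in> products H X" "y \<in> products H X"
  shows "x \<otimes> y \<in> products H X"
  using assms(2,1,3)
proof (induction rule: products.induct)
  case (single x) then show ?case by (auto intro: products.step)
next
  case (step x z)
  have "(x \<otimes> z) \<otimes> y = x \<otimes> (z \<otimes> y)"
    using step products_closed[OF assms(1)] by (intro mult_assoc) auto
  then show ?case using step by (auto intro: products.step)
qed

lemma products_star:
  assumes "X \<subseteq> carrier H" "x \<in> products H (X \<union> star H ` X)"
  shows "x\<^sup>\<star> \<in> products H (X \<union> star H ` X)"
  using assms(2)
proof (induction rule: products.induct)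
  case (single x)
  then have "x\<^sup>\<star> \<in> X \<union> star H ` X" using assms(1) by auto
  then show ?case by (rule products.single)
next
  case (step x y)
  have X: "X \<union> star H ` X \<subseteq> carrier H" using assms(1) by auto
  have "x\<^sup>\<star> \<in> X \<union> star H ` X" using step(1) assms(1) by auto
  moreover have "(x \<otimes> y)\<^sup>\<star> = y\<^sup>\<star> \<otimes> x\<^sup>\<star>"
    using step X products_closed[OF X] by (intro star_mult) auto
  ultimately show ?case using step products_mult[OF X] by (simp add: products.single)
qed

lemma generated_subset: assumes "X \<subseteq> carrier H" shows "generated H X \<subseteq> carrier H"
  using products_closed[of "X \<union> star H ` X"] assms unfolding generated_def by auto

lemma generated_mult:
  assumes "X \<subseteq> carrier H" "x \<in> generated H X" "y \<in> generated H X"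
  shows "x \<otimes> y \<in> generated H X"
proof -
  have X: "X \<union> star H ` X \<subseteq> carrier H" using assms(1) by auto
  show ?thesis using assms generated_subset[OF assms(1)] products_mult[OF X]
    unfolding generated_def by auto
qed

lemma generated_star:
  assumes "X \<subseteq> carrier H" "x \<in> generated H X" shows "x\<^sup>\<star> \<in> generated H X"
  using assms products_star[OF assms(1)] unfolding generated_def by auto

lemma is_inverse_carrier_update:
  "is_inverse (H\<lparr>carrier := Y\<rparr>) x y \<longleftrightarrow> y \<in> Y \<and> x \<otimes> y \<otimes> x = x \<and> y \<otimes> x \<otimes> y = y"
  by (simp add: is_inverse_def)

text \<open>\<open>star\<close> is a description over the carrier, so its value in a subsemigroup
  must be compared with the ambient one; closure of the generated set under inverses makes them
  agree.\<close>

lemma generated_is_inverse_iff: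
  assumes "X \<subseteq> carrier H" "x \<in> generated H X"
  shows "is_inverse (H\<lparr>carrier := generated H X\<rparr>) x y \<longleftrightarrow> y = x\<^sup>\<star>"
  using assms star_unique[of x y] generated_subset[OF assms(1)] generated_star[OF assms]
    star_is_inverse[of x]
  unfolding is_inverse_carrier_update by (auto simp: is_inverse_def)

lemma generated_inverse_semigroup:
  assumes "X \<subseteq> carrier H"
  shows "inverse_semigroup_zero (H\<lparr>carrier := generated H X\<rparr>)"
  using generated_subset[OF assms] generated_mult[OF assms] generated_is_inverse_iff[OF assms]
  by unfold_locales (auto simp: mult_assoc subset_eq generated_def)

lemma generated_star_eq:
  assumes "X \<subseteq> carrier H" "x \<in> generated H X"
  shows "star (H\<lparr>carrier := generated H X\<rparr>) x = x\<^sup>\<star>"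
  unfolding star_def[of "H\<lparr>carrier := generated H X\<rparr>"]
  using generated_is_inverse_iff[OF assms] by auto

end


section \<open>Words of a Markov subshift\<close>

text \<open>No row of \<open>T\<close> vanishes, so a choice \<open>f\<close> of successors
  continues any admissible finite word forever, and the sequence can be started at index 0.
  Occurrence in the subshift thus becomes a local condition.\<close>

lemma lang_iff:
  assumes "transition_matrix B T"
  shows "w \<in> lang B T \<longleftrightarrow> w \<noteq> [] \<and> set w \<subseteq> B \<and> successively (\<lambda>a b. T a b = 1) w"
proof
  assume "w \<in> lang B T"
  then obtain a i n where "w \<noteq> []" "\<forall>i. a i \<in> B \<and> T (a i) (a (Suc i)) = 1" "w = map a [i..<i + n]"
    unfolding lang_def subshift_def by blast
  then show "w \<noteq> [] \<and> set w \<subseteq> B \<and> successively (\<lambda>a b. T a b = 1) w"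
    by (auto simp: successively_conv_nth)
next
  have "\<forall>a\<in>B. \<exists>b\<in>B. T a b = 1" using assms by (force simp: transition_matrix_def)
  then obtain f where f: "\<And>a. a \<in> B \<Longrightarrow> f a \<in> B \<and> T a (f a) = 1" by metis
  assume "w \<noteq> [] \<and> set w \<subseteq> B \<and> successively (\<lambda>a b. T a b = 1) w"
  then have "w \<noteq> []" "set w \<subseteq> B" "successively (\<lambda>a b. T a b = 1) w" by auto
  then have "\<exists>a\<in>subshift B T. w = map a [0..<length w]"
  proof (induction w rule: induct_list012)
    case (2 x)
    have "(f ^^ i) x \<in> B" for i using 2 f by (induction i) auto
    then have "(\<lambda>i. (f ^^ i) x) \<in> subshift B T" using f by (simp add: subshift_def)
    then show ?case by (rule rev_bexI) simp
  next
    case (3 x y zs)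
    then obtain a where a: "a \<in> subshift B T" "y # zs = map a [0..<length (y # zs)]" by auto
    have "a 0 = y" using arg_cong[OF a(2), of hd] by (simp add: hd_map del: upt_Suc)
    then have "case_nat x a \<in> subshift B T"
      using a(1) 3 by (auto simp: subshift_def split: nat.split)
    moreover have "x # y # zs = map (case_nat x a) [0..<length (x # y # zs)]"
      using a(2) by (simp add: map_upt_Suc del: upt_Suc)
    ultimately show ?case by (intro bexI[of _ "case_nat x a"])
  qed simp
  then show "w \<in> lang B T" using \<open>w \<noteq> []\<close> unfolding lang_def
    by (metis (mono_tags, lifting) add_0 mem_Collect_eq)
qed

lemma lang_append:
  assumes "transition_matrix B T" "u \<noteq> []" "v \<noteq> []"
  shows "u @ v \<in> lang B T \<longleftrightarrow> u \<in> lang B T \<and> v \<in> lang B T \<and> T (last u) (hd v) = 1"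
  using assms by (auto simp: lang_iff successively_append_iff)

lemma lang_single: "transition_matrix B T \<Longrightarrow> [b] \<in> lang B T \<longleftrightarrow> b \<in> B"
  by (simp add: lang_iff)


section \<open>Partial bijections\<close>

lemma partial_bijections_simps [simp]:
  "mult (partial_bijections X) = (\<circ>\<^sub>m)" "zero (partial_bijections X) = Map.empty"
  by (simp_all add: partial_bijections_def)

lemma partial_bijections_carrier:
  "f \<in> carrier (partial_bijections X) \<longleftrightarrow>
     (\<forall>x y. f x = Some y \<longrightarrow> x \<in> X \<and> y \<in> X) \<and> (\<forall>x x' y. f x = Some y \<longrightarrow> f x' = Some y \<longrightarrow> x = x')"
  by (auto simp: partial_bijections_def inj_on_def ran_def dom_def subset_eq)

lemma map_eqI: "(\<And>x y. f x = Some y \<longleftrightarrow> g x = Some y) \<Longrightarrow> f = g"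
  by (metis not_None_eq ext)

text \<open>Injectivity of \<open>f\<close> cancels it from \<open>f g f = f\<close>, so
  \<open>g\<close> undoes \<open>f\<close>; injectivity of \<open>g\<close> and
  \<open>g f g = g\<close> give the rest.\<close>

lemma is_inverse_partial_bijections_iff:
  assumes "f \<in> carrier (partial_bijections X)"
  shows "is_inverse (partial_bijections X) f g \<longleftrightarrow> (\<forall>x y. g y = Some x \<longleftrightarrow> f x = Some y)"
proof
  assume g: "is_inverse (partial_bijections X) f g"
  have fgf: "((f \<circ>\<^sub>m g) \<circ>\<^sub>m f) x = f x" and gfg: "((g \<circ>\<^sub>m f) \<circ>\<^sub>m g) x = g x" for x
    using g by (auto simp: is_inverse_def)
  have "g \<in> carrier (partial_bijections X)" using g by (simp add: is_inverse_def)
  then show "\<forall>x y. g y = Some x \<longleftrightarrow> f x = Some y"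
    using assms fgf gfg unfolding partial_bijections_carrier
    by (smt (verit) map_comp_Some_iff map_comp_simps(2))
next
  assume g: "\<forall>x y. g y = Some x \<longleftrightarrow> f x = Some y"
  have "(f \<circ>\<^sub>m g) \<circ>\<^sub>m f = f" "(g \<circ>\<^sub>m f) \<circ>\<^sub>m g = g"
    using g assms by (auto intro!: map_eqI simp: map_comp_Some_iff partial_bijections_carrier)
  then show "is_inverse (partial_bijections X) f g"
    using g assms by (simp add: is_inverse_def partial_bijections_carrier)
qed

lemma partial_bijections_inverse_semigroup: "inverse_semigroup_zero (partial_bijections X)"
proof
  fix s assume s: "s \<in> carrier (partial_bijections X)"
  have "\<exists>g. \<forall>x y. g y = Some x \<longleftrightarrow> s x = Some y"
  proof (intro exI allI)
    fix x y
    show "(if \<exists>x. s x = Some y then Some (THE x. s x = Some y) else None) = Some x \<longleftrightarrow> s x = Some y"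
      using s by (auto simp: partial_bijections_carrier intro: theI)
  qed
  then obtain g where g: "\<forall>x y. g y = Some x \<longleftrightarrow> s x = Some y" by blast
  show "\<exists>!t. is_inverse (partial_bijections X) s t"
    unfolding is_inverse_partial_bijections_iff[OF s]
    using g by (intro ex1I[of _ g]) (auto intro!: map_eqI)
next
  fix x y z :: "'a \<rightharpoonup> 'a"
  show "(x \<otimes>\<^bsub>partial_bijections X\<^esub> y) \<otimes>\<^bsub>partial_bijections X\<^esub> z
    = x \<otimes>\<^bsub>partial_bijections X\<^esub> (y \<otimes>\<^bsub>partial_bijections X\<^esub> z)"
    by (auto intro!: map_eqI simp: map_comp_Some_iff)
qed (auto simp: partial_bijections_carrier map_comp_Some_iff intro!: map_eqI)

interpretation PB: inverse_semigroup_zero "partial_bijections X" for X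
  by (rule partial_bijections_inverse_semigroup)

lemma star_partial_bijections:
  assumes "f \<in> carrier (partial_bijections X)"
  shows "star (partial_bijections X) f y = Some x \<longleftrightarrow> f x = Some y"
  using PB.star_is_inverse[OF assms] assms by (simp add: is_inverse_partial_bijections_iff)

lemma theta_Some_iff:
  "theta W s x = Some y \<longleftrightarrow> x \<in> W \<and> s @ x \<in> W \<and> y = s @ x"
  by (auto simp: theta_def)

lemma theta_carrier: "theta W s \<in> carrier (partial_bijections W)"
  by (auto simp: partial_bijections_carrier theta_Some_iff)

lemma theta_image_subset: "theta W ` V \<subseteq> carrier (partial_bijections W)"
  by (auto intro: theta_carrier)

lemma inverse_hull_eq:
  "inverse_hull B T = partial_bijections (lang B T)
     \<lparr>carrier := generated (partial_bijections (lang B T)) (theta (lang B T) ` lang B T)\<rparr>"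
  by (simp add: inverse_hull_def Let_def)

lemma inverse_hull_simps [simp]:
  "mult (inverse_hull B T) = (\<circ>\<^sub>m)" "zero (inverse_hull B T) = Map.empty"
  by (simp_all add: inverse_hull_eq)

lemma inverse_hull_carrier:
  "carrier (inverse_hull B T) = generated (partial_bijections (lang B T)) (theta (lang B T) ` lang B T)"
  by (simp_all add: inverse_hull_eq)

lemma inverse_hull_inverse_semigroup: "inverse_semigroup_zero (inverse_hull B T)"
  unfolding inverse_hull_eq by (rule PB.generated_inverse_semigroup[OF theta_image_subset])

lemma inverse_hull_carrier_subset:
  "carrier (inverse_hull B T) \<subseteq> carrier (partial_bijections (lang B T))"
  using PB.generated_subset[OF theta_image_subset] by (simp add: inverse_hull_carrier)

lemma star_inverse_hull_eq:
  "f \<in> carrier (inverse_hull B T) \<Longrightarrow> star (inverse_hull B T) f = star (partial_bijections (lang B T)) f"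
  unfolding inverse_hull_eq by (rule PB.generated_star_eq[OF theta_image_subset]) simp

lemma star_inverse_hull:
  assumes "f \<in> carrier (inverse_hull B T)"
  shows "star (inverse_hull B T) f y = Some x \<longleftrightarrow> f x = Some y"
  unfolding star_inverse_hull_eq[OF assms]
  by (rule star_partial_bijections[OF subsetD[OF inverse_hull_carrier_subset assms]])

lemma theta_hull: "w \<in> lang B T \<Longrightarrow> theta (lang B T) w \<in> carrier (inverse_hull B T)"
  by (auto simp: inverse_hull_carrier generated_def intro: products.single)


section \<open>The inverse hull satisfies the conditions\<close>

definition partial_id :: "'c set \<Rightarrow> ('c \<rightharpoonup> 'c)" where
  "partial_id D = (\<lambda>w. if w \<in> D then Some w else None)"

lemma partial_id_Some_iff [simp]: "partial_id D w = Some w' \<longleftrightarrow> w \<in> D \<and> w' = w"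
  by (auto simp: partial_id_def)

lemma partial_id_comp [simp]: "partial_id D \<circ>\<^sub>m partial_id D' = partial_id (D \<inter> D')"
  by (auto intro!: map_eqI simp: map_comp_Some_iff)

lemma partial_id_eq_iff [simp]: "partial_id D = partial_id D' \<longleftrightarrow> D = D'"
proof
  assume "partial_id D = partial_id D'"
  then have "w \<in> D \<longleftrightarrow> w \<in> D'" for w by (metis partial_id_Some_iff)
  then show "D = D'" by blast
qed simp

lemma partial_id_empty: "Map.empty = partial_id {}"
  by (simp add: partial_id_def)

locale markov_hull =
  fixes B :: "'b set" and T :: "'b \<Rightarrow> 'b \<Rightarrow> nat"
  assumes tm: "transition_matrix B T"
begin

abbreviation "W \<equiv> lang B T"
abbreviation "G \<equiv> inverse_hull B T"

sublocale G: inverse_semigroup_zero "inverse_hull B T"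
  by (rule inverse_hull_inverse_semigroup)

definition row :: "'b \<Rightarrow> 'b set" where "row b = {b' \<in> B. T b b' = 1}"

text \<open>\<open>s\<close> is never empty, so \<open>t\<close> itself is not in
  \<open>cyl t R\<close>; in particular, for a letter \<open>b\<close> of \<open>B\<close>,
  \<open>cyl [b] (row b)\<close> consists of the proper extensions of the word
  \<open>[b]\<close>.\<close>

definition cyl :: "'b list \<Rightarrow> 'b set \<Rightarrow> 'b list set" where
  "cyl t R = {t @ s | s. s \<in> W \<and> hd s \<in> R}"

text \<open>The nonzero elements of the hull are the maps \<open>ts \<mapsto> us\<close>, where \<open>s\<close> runs through the words
  whose first letter lies in a given set \<open>R\<close>.\<close>

definition shape :: "('b list \<rightharpoonup> 'b list) \<Rightarrow> 'b list \<Rightarrow> 'b set \<Rightarrow> 'b list \<Rightarrow> bool" where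
  "shape f u R t \<longleftrightarrow> R \<subseteq> B \<and>
     (\<forall>w w'. f w = Some w' \<longleftrightarrow> (\<exists>s\<in>W. hd s \<in> R \<and> w = t @ s \<and> w' = u @ s))"

lemma row_subset: "row b \<subseteq> B" and row_nonempty: "b \<in> B \<Longrightarrow> row b \<noteq> {}"
  using tm by (force simp: row_def transition_matrix_def)+

lemma single_W: "b \<in> B \<Longrightarrow> [b] \<in> W"
  using lang_single[OF tm] by simp

lemma W_nonempty: "w \<in> W \<Longrightarrow> w \<noteq> []" and W_hd: "w \<in> W \<Longrightarrow> hd w \<in> B"
  and W_last: "w \<in> W \<Longrightarrow> last w \<in> B"
  using lang_iff[OF tm] by auto

lemma W_suffix: "\<lbrakk>x @ y \<in> W; y \<noteq> []\<rbrakk> \<Longrightarrow> y \<in> W"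
  using lang_append[OF tm, of x y] by (cases "x = []") auto

lemma W_append_iff:
  "\<lbrakk>u \<in> W; s \<in> W\<rbrakk> \<Longrightarrow> u @ s \<in> W \<longleftrightarrow> hd s \<in> row (last u)"
  using lang_append[OF tm, of u s] by (auto simp: row_def W_hd dest: W_nonempty)

lemma hull_dom: "\<lbrakk>f \<in> carrier G; f w = Some w'\<rbrakk> \<Longrightarrow> w \<in> W \<and> w' \<in> W"
  and hull_inj: "\<lbrakk>f \<in> carrier G; f w = Some w'; f w'' = Some w'\<rbrakk> \<Longrightarrow> w = w''"
  using inverse_hull_carrier_subset[of B T] by (auto simp: partial_bijections_carrier subset_eq)

lemma shape_Some: "shape f u R t \<Longrightarrow> f w = Some w' \<longleftrightarrow> (\<exists>s\<in>W. hd s \<in> R \<and> w = t @ s \<and> w' = u @ s)"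
  unfolding shape_def by blast

lemma shape_eq: "\<lbrakk>shape f u R t; shape g u R t\<rbrakk> \<Longrightarrow> f = g"
  by (auto intro!: map_eqI simp: shape_Some)

lemma shape_theta: "w \<in> W \<Longrightarrow> shape (theta W w) w (row (last w)) []"
  unfolding shape_def using row_subset W_append_iff by (auto simp: theta_Some_iff)

lemma shape_star: "\<lbrakk>f \<in> carrier G; shape f u R t\<rbrakk> \<Longrightarrow> shape (star G f) t R u"
  unfolding shape_def by (auto simp: star_inverse_hull)

text \<open>\<open>u\<close> and \<open>t\<close> are arbitrary here, so a shape determines its
  words only when \<open>R\<close> is nonempty.\<close>

lemma shape_empty: "shape Map.empty u {} t"
  by (simp add: shape_def)

text \<open>The output word \<open>u'\<close> of \<open>g\<close> meets the input word
  \<open>t\<close> of \<open>f\<close>. If one properly extends the other, the excess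
  \<open>p\<close> is carried to the outer output or input word; if they are equal, \<open>R\<close>
  and \<open>R'\<close> intersect; if they are incomparable, nothing is left.\<close>

lemma shape_comp:
  assumes f: "f \<in> carrier G" "shape f u R t" and g: "g \<in> carrier G" "shape g u' R' t'"
  shows "\<exists>u R t. shape (f \<circ>\<^sub>m g) u R t"
proof -
  have RB: "R \<subseteq> B" "R' \<subseteq> B" using f g by (auto simp: shape_def)
  have fg: "(f \<circ>\<^sub>m g) w = Some w' \<longleftrightarrow> (\<exists>s\<in>W. \<exists>s'\<in>W. hd s \<in> R \<and> hd s' \<in> R' \<and>
      w = t' @ s' \<and> u' @ s' = t @ s \<and> w' = u @ s)" for w w'
    using shape_Some[OF f(2)] shape_Some[OF g(2)] by (auto simp: map_comp_Some_iff)
  have Wf: "t @ s \<in> W" if "s \<in> W" "hd s \<in> R" for s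
    using hull_dom[OF f(1)] shape_Some[OF f(2)] that by blast
  have Wg: "u' @ s \<in> W" if "s \<in> W" "hd s \<in> R'" for s
    using hull_dom[OF g(1)] shape_Some[OF g(2)] that by blast
  consider p where "u' = t @ p" "p \<noteq> []" | "t = u'" | p where "t = u' @ p" "p \<noteq> []"
    | "\<nexists>p. u' = t @ p" "\<nexists>p. t = u' @ p" by (metis append_Nil2)
  then show ?thesis
  proof cases
    case 1
    have "p @ s \<in> W" if "s \<in> W" "hd s \<in> R'" for s
      using Wg[OF that] 1 W_suffix[of t "p @ s"] by simp
    \<comment> \<open>\<open>f\<close> tests only the first letter of what follows \<open>t\<close>,
      here that of \<open>p\<close>, so it admits either all continuations or none.\<close>
    then have "shape (f \<circ>\<^sub>m g) (u @ p) (if hd p \<in> R then R' else {}) t'"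
      using 1 RB unfolding shape_def fg by auto
    then show ?thesis by blast
  next
    case 2
    then have "shape (f \<circ>\<^sub>m g) u (R \<inter> R') t'" using RB unfolding shape_def fg by auto
    then show ?thesis by blast
  next
    case 3
    have "p @ s \<in> W" if "s \<in> W" "hd s \<in> R" for s
      using Wf[OF that] 3 W_suffix[of u' "p @ s"] by simp
    then have "shape (f \<circ>\<^sub>m g) u (if hd p \<in> R' then R else {}) (t' @ p)"
      using 3 RB unfolding shape_def fg by auto
    then show ?thesis by blast
  next
    case 4
    then have "shape (f \<circ>\<^sub>m g) u {} t'" unfolding shape_def fg
      by (auto simp: append_eq_append_conv2)
    then show ?thesis by blast
  qed
qed

lemma hull_products_subset:
  "products (partial_bijections W) (theta W ` W \<union> star (partial_bijections W) ` theta W ` W) \<subseteq> carrier G"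
  by (auto simp: inverse_hull_carrier generated_def)

lemma hull_shape: assumes "f \<in> carrier G" obtains u R t where "shape f u R t"
proof -
  let ?X = "theta W ` W \<union> star (partial_bijections W) ` theta W ` W"
  have X: "\<exists>u R t. shape x u R t" if x: "x \<in> ?X" for x
    using x shape_theta shape_star[OF theta_hull] star_inverse_hull_eq[OF theta_hull] by fastforce
  have "\<exists>u R t. shape f u R t" if "f \<in> products (partial_bijections W) ?X" for f
    using that
  proof (induction rule: products.induct)
    case (step x y)
    have "x \<in> carrier G" "y \<in> carrier G"
      using step(1,2) hull_products_subset products.single[of x ?X "partial_bijections W"] by blast+
    then show ?case using shape_comp X[OF step(1)] step(3) by simp blast
  qed (rule X)
  moreover have "f = Map.empty \<or> f \<in> products (partial_bijections W) ?X"
    using assms by (simp add: inverse_hull_carrier generated_def)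
  ultimately have "\<exists>u R t. shape f u R t" using shape_empty by blast
  then show ?thesis using that by blast
qed

lemma shape_star_mult:
  "\<lbrakk>f \<in> carrier G; shape f u R t\<rbrakk> \<Longrightarrow> star G f \<circ>\<^sub>m f = partial_id (cyl t R)"
  "\<lbrakk>f \<in> carrier G; shape f u R t\<rbrakk> \<Longrightarrow> f \<circ>\<^sub>m star G f = partial_id (cyl u R)"
  by (auto intro!: map_eqI simp: map_comp_Some_iff star_inverse_hull shape_Some cyl_def)

section \<open>Cylinders and the idempotents of the hull\<close>

lemma cyl_eq_empty_iff: "R \<subseteq> B \<Longrightarrow> cyl t R = {} \<longleftrightarrow> R = {}"
  using single_W by (fastforce simp: cyl_def)

lemma cyl_mem: "\<lbrakk>b \<in> R; R \<subseteq> B\<rbrakk> \<Longrightarrow> t @ [b] \<in> cyl t R"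
  using single_W by (auto simp: cyl_def)

lemma cyl_Int: "cyl t R \<inter> cyl t R' = cyl t (R \<inter> R')"
  by (auto simp: cyl_def)

text \<open>A shortest word of \<open>cyl t R\<close> is \<open>t\<close> followed by one letter of
  \<open>R\<close>; placing such words of each side in the other compares lengths both ways.\<close>

lemma cyl_inj:
  assumes "cyl t R = cyl t' R'" "R \<noteq> {}" "R' \<noteq> {}" "R \<subseteq> B" "R' \<subseteq> B"
  shows "t = t' \<and> R = R'"
proof -
  obtain b b' where b: "b \<in> R" "b' \<in> R'" using assms by auto
  have "t @ [b] \<in> cyl t' R'" "t' @ [b'] \<in> cyl t R" using b cyl_mem assms by metis+
  then obtain s s' where s: "s \<in> W" "t @ [b] = t' @ s" "s' \<in> W" "t' @ [b'] = t @ s'"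
    unfolding cyl_def by auto
  have "1 \<le> length s" "1 \<le> length s'" using s W_nonempty by (auto simp: Suc_le_eq)
  moreover have "length t + 1 = length t' + length s" "length t' + 1 = length t + length s'"
    using arg_cong[OF s(2), of length] arg_cong[OF s(4), of length] by simp_all
  ultimately have "length t = length t'" by linarith
  then have t: "t = t'" using s(2) by simp
  have mem: "t @ [c] \<in> cyl t S \<Longrightarrow> c \<in> S" for c S by (auto simp: cyl_def)
  have "cyl t R = cyl t R'" using assms(1) t by simp
  then have "c \<in> R \<longleftrightarrow> c \<in> R'" for c
    using cyl_mem[of c R t] cyl_mem[of c R' t] mem[of c R] mem[of c R'] assms(4,5) by blast
  then show ?thesis using t by blast
qed

lemma hull_idem_Some:
  assumes e: "e \<in> idems G" and w: "e w = Some w'" shows "w = w'"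
proof -
  have c: "e \<in> carrier G" and "e \<circ>\<^sub>m e = e" using e G.idems_mult_self[OF e] by auto
  then have "(e \<circ>\<^sub>m e) w = Some w'" using w by simp
  then have "e w' = Some w'" using w by (simp add: map_comp_Some_iff)
  then show ?thesis using hull_inj[OF c] w by blast
qed

text \<open>An idempotent fixes its domain pointwise, which forces the two words of its shape to
  agree once \<open>R\<close> is inhabited; for empty \<open>R\<close> every cylinder is
  empty.\<close>

lemma hull_idem:
  assumes e: "e \<in> idems G"
  obtains t R where "e = partial_id (cyl t R)" "R \<subseteq> B" "cyl t R \<subseteq> W"
proof -
  have c: "e \<in> carrier G" using e by blast
  obtain u R t where s: "shape e u R t" using hull_shape c by blast
  have "u = t" if "x \<in> W" "hd x \<in> R" for x
    using hull_idem_Some[OF e, of "t @ x" "u @ x"] shape_Some[OF s, of "t @ x" "u @ x"] that by auto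
  then have "e w = Some w' \<longleftrightarrow> w \<in> cyl t R \<and> w' = w" for w w'
    using shape_Some[OF s, of w w'] by (auto simp: cyl_def)
  then have "e = partial_id (cyl t R)" by (auto intro!: map_eqI)
  moreover from this have "cyl t R \<subseteq> W"
    using hull_dom[OF c] by (auto simp: subset_eq)
  ultimately show ?thesis using s that by (auto simp: shape_def)
qed

text \<open>This is \<open>theta W [b]\<close> times its inverse, by \<open>theta_star_mult\<close>;
  written as an identity map it turns the order of idempotents into inclusion of cylinders.\<close>

definition q :: "'b \<Rightarrow> ('b list \<rightharpoonup> 'b list)" where "q b = partial_id (cyl [b] (row b))"

abbreviation "hull_O \<equiv> q ` B"

lemma natural_le_partial_id:
  "\<lbrakk>partial_id D \<in> idems G; partial_id D' \<in> idems G\<rbrakk> \<Longrightarrow> natural_le G (partial_id D) (partial_id D') \<longleftrightarrow> D \<subseteq> D'"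
  using G.natural_le_idems by auto

lemma theta_star_mult:
  assumes "w \<in> W"
  shows "star G (theta W w) \<circ>\<^sub>m theta W w = partial_id (cyl [] (row (last w)))"
    and "theta W w \<circ>\<^sub>m star G (theta W w) = partial_id (cyl w (row (last w)))"
  using shape_star_mult[OF theta_hull[OF assms] shape_theta[OF assms]] .

lemma q_idem: "b \<in> B \<Longrightarrow> q b \<in> idems G"
  using theta_star_mult(2)[OF single_W] G.mult_star_idem[OF theta_hull[OF single_W]]
  by (simp add: q_def)

lemma q_nonzero: "b \<in> B \<Longrightarrow> q b \<noteq> Map.empty"
  using cyl_eq_empty_iff row_subset row_nonempty by (simp add: q_def partial_id_empty)

lemma cyl_single_subset: "b \<in> R \<Longrightarrow> b \<in> B \<Longrightarrow> cyl [b] (row b) \<subseteq> cyl [] R"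
  using W_append_iff[OF single_W, of b] by (force simp: cyl_def)

text \<open>A word \<open>[b, b']\<close> of the left side, which exists because
  \<open>row b\<close> is nonempty, reveals \<open>b\<close>. So \<open>R\<close> can be recovered
  from the letter idempotents below \<open>partial_id (cyl [] R)\<close>, which is what (O4) asks
  for.\<close>

lemma cyl_single_subset_iff: "b \<in> B \<Longrightarrow> cyl [b] (row b) \<subseteq> cyl [] R \<longleftrightarrow> b \<in> R"
  using cyl_mem[of _ "row b" "[b]"] row_nonempty[of b] row_subset[of b] cyl_single_subset[of b R]
  by (force simp: cyl_def)

lemma cyl_single_disjoint: "b \<noteq> b' \<Longrightarrow> cyl [b] R \<inter> cyl [b'] R' = {}"
  by (auto simp: cyl_def)

text \<open>If \<open>cyl t R\<close> contains \<open>cyl [b] (row b)\<close>, its two-letter words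
  \<open>[b, b']\<close> leave only \<open>[]\<close> and \<open>[b]\<close> for \<open>t\<close>.
  With \<open>t = [b]\<close>, this containment and the inclusion of \<open>cyl t R\<close> in
  \<open>W\<close> force \<open>R = row b\<close>, and the idempotent is \<open>q b\<close> itself,
  which the set difference removes.\<close>

lemma hull_upper_iff:
  "\<alpha> \<in> up_set G hull_O - hull_O \<longleftrightarrow>
     \<alpha> \<in> idems G \<and> (\<exists>R. R \<subseteq> B \<and> R \<noteq> {} \<and> \<alpha> = partial_id (cyl [] R))"
proof
  assume a: "\<alpha> \<in> up_set G hull_O - hull_O"
  then have i: "\<alpha> \<in> idems G" by (simp add: up_set_def)
  obtain b where b: "b \<in> B" "natural_le G (q b) \<alpha>" using a by (auto simp: up_set_def)
  obtain t R where R: "\<alpha> = partial_id (cyl t R)" "R \<subseteq> B" "cyl t R \<subseteq> W" using hull_idem[OF i] by blast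
  have sub: "cyl [b] (row b) \<subseteq> cyl t R"
    using b i q_idem unfolding R q_def by (simp add: natural_le_partial_id)
  have mem: "[b, b'] \<in> cyl t R" if "b' \<in> row b" for b'
    using cyl_mem[of b' "row b" "[b]"] row_subset sub that by auto
  obtain b' where b': "b' \<in> row b" using row_nonempty b by blast
  have "t = []"
  proof (rule ccontr)
    assume "t \<noteq> []"
    then have t: "t = [b]" using mem[OF b'] W_nonempty by (auto simp: cyl_def Cons_eq_append_conv)
    have "row b \<subseteq> R" using mem unfolding t by (auto simp: cyl_def)
    moreover have "R \<subseteq> row b"
      using R(2,3) cyl_mem[of _ R "[b]"] W_append_iff[OF single_W single_W] b(1) unfolding t by force
    ultimately have "\<alpha> = q b" using R(1) t by (simp add: q_def)
    then show False using a b by blast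
  qed
  moreover have "R \<noteq> {}" using sub b' cyl_mem row_subset by (force simp: cyl_def)
  ultimately show "\<alpha> \<in> idems G \<and> (\<exists>R. R \<subseteq> B \<and> R \<noteq> {} \<and> \<alpha> = partial_id (cyl [] R))"
    using i R by auto
next
  assume a: "\<alpha> \<in> idems G \<and> (\<exists>R. R \<subseteq> B \<and> R \<noteq> {} \<and> \<alpha> = partial_id (cyl [] R))"
  then obtain R b where R: "R \<subseteq> B" "b \<in> R" "\<alpha> = partial_id (cyl [] R)" and i: "\<alpha> \<in> idems G"
    by blast
  have "natural_le G (q b) \<alpha>"
    using q_idem[of b] i R cyl_single_subset[of b R] unfolding q_def R(3)
    by (subst natural_le_partial_id) auto
  moreover have "\<alpha> \<noteq> q b'" if "b' \<in> B" for b'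
    using R cyl_inj[of "[]" R "[b']" "row b'"] row_subset row_nonempty[OF that] by (auto simp: q_def)
  ultimately show "\<alpha> \<in> up_set G hull_O - hull_O"
    using i R by (auto simp: up_set_def)
qed

lemma hull_upper_D:
  assumes "\<alpha> \<in> up_set G hull_O - hull_O"
  obtains R where "\<alpha> = partial_id (cyl [] R)" "R \<subseteq> B" "R \<noteq> {}" "\<alpha> \<in> idems G"
  using assms unfolding hull_upper_iff by blast

lemma hull_O_subset_up: "hull_O \<subseteq> up_set G hull_O"
proof
  fix e assume "e \<in> hull_O"
  then obtain b where b: "b \<in> B" "e = q b" by blast
  then have "natural_le G e e" using q_idem[of b] by (simp add: G.natural_le_idems q_def)
  then show "e \<in> up_set G hull_O" using b q_idem by (auto simp: up_set_def)
qed

section \<open>Verification of (O1)-(O5) in the hull\<close>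

lemma hull_O1: "O1 G hull_O"
  unfolding O1_def
proof (intro ballI impI, elim imageE)
  fix e f b b' assume "e \<noteq> f" "e = q b" "f = q b'"
  then show "e \<otimes>\<^bsub>G\<^esub> f = \<zero>\<^bsub>G\<^esub>"
    using cyl_single_disjoint[of b b'] by (auto simp: q_def partial_id_empty)
qed

text \<open>The word \<open>t\<close> of the idempotent decides: if it begins with \<open>a\<close>,
  the idempotent lies below \<open>q a\<close>; if it is empty, any letter of \<open>R\<close> gives
  a member below it. The zero idempotent lies below any \<open>q b\<close>, and \<open>B\<close> is
  nonempty.\<close>

lemma hull_O2: "O2 G hull_O"
  unfolding O2_def
proof
  fix f assume f: "f \<in> idems G"
  obtain t R where R: "f = partial_id (cyl t R)" "R \<subseteq> B" "cyl t R \<subseteq> W" using hull_idem[OF f] by blast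
  have le: "natural_le G f (q b) \<longleftrightarrow> cyl t R \<subseteq> cyl [b] (row b)"
    "natural_le G (q b) f \<longleftrightarrow> cyl [b] (row b) \<subseteq> cyl t R" if "b \<in> B" for b
    using q_idem[OF that] f unfolding R q_def by (simp_all add: natural_le_partial_id)
  have "\<exists>b\<in>B. cyl t R \<subseteq> cyl [b] (row b) \<or> cyl [b] (row b) \<subseteq> cyl t R"
  proof (cases "R = {}")
    case True
    then show ?thesis using tm by (auto simp: cyl_def transition_matrix_def)
  next
    case False
    then obtain b where b: "b \<in> R" by blast
    show ?thesis
    proof (cases t)
      case Nil
      then show ?thesis using b R cyl_single_subset by blast
    next
      case (Cons a t')
      have *: "t' @ s \<in> W \<and> hd (t' @ s) \<in> row a \<and> a \<in> B" if "s \<in> W" "hd s \<in> R" for s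
      proof -
        have m: "[a] @ (t' @ s) \<in> W" using R(3) that by (auto simp: cyl_def Cons)
        then have a: "a \<in> B" using W_hd by fastforce
        have "t' @ s \<in> W" using W_suffix[OF m] W_nonempty[OF that(1)] by simp
        then show ?thesis using W_append_iff[OF single_W[OF a]] m a by fastforce
      qed
      then have "cyl t R \<subseteq> cyl [a] (row a)" by (force simp: cyl_def Cons)
      moreover have "a \<in> B" using *[OF single_W] b R by auto
      ultimately show ?thesis by blast
    qed
  qed
  then show "\<exists>e\<in>hull_O. natural_le G f e \<or> natural_le G e f" using le by blast
qed

lemma hull_upper_mult:
  assumes "\<alpha> \<in> up_set G hull_O - hull_O" "\<beta> \<in> up_set G hull_O - hull_O" "\<alpha> \<circ>\<^sub>m \<beta> \<noteq> Map.empty"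
  shows "\<alpha> \<circ>\<^sub>m \<beta> \<in> up_set G hull_O - hull_O"
proof -
  obtain R where R: "\<alpha> = partial_id (cyl [] R)" "R \<subseteq> B" "\<alpha> \<in> idems G"
    using hull_upper_D[OF assms(1)] .
  obtain R' where R': "\<beta> = partial_id (cyl [] R')" "R' \<subseteq> B" "\<beta> \<in> idems G"
    using hull_upper_D[OF assms(2)] .
  have "\<alpha> \<circ>\<^sub>m \<beta> \<in> idems G" using G.idems_mult[OF R(3) R'(3)] by simp
  moreover have eq: "\<alpha> \<circ>\<^sub>m \<beta> = partial_id (cyl [] (R \<inter> R'))" using R R' by (simp add: cyl_Int)
  moreover have "R \<inter> R' \<noteq> {}" using assms(3) unfolding eq by (auto simp: partial_id_empty cyl_def)
  ultimately show ?thesis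
    using R(2) unfolding hull_upper_iff by (intro conjI exI[of _ "R \<inter> R'"]) auto
qed

lemma hull_upper_q:
  assumes "\<alpha> \<in> up_set G hull_O - hull_O" "b \<in> B"
  shows "\<alpha> \<circ>\<^sub>m q b = q b \<or> \<alpha> \<circ>\<^sub>m q b = Map.empty"
proof -
  obtain R where R: "\<alpha> = partial_id (cyl [] R)" using hull_upper_D[OF assms(1)] .
  show ?thesis
  proof (cases "b \<in> R")
    case True
    then have "cyl [] R \<inter> cyl [b] (row b) = cyl [b] (row b)"
      using cyl_single_subset[OF _ assms(2)] by blast
    then show ?thesis by (simp add: R q_def)
  next
    case False
    then have "cyl [] R \<inter> cyl [b] (row b) = {}" by (auto simp: cyl_def)
    then show ?thesis by (simp add: R q_def partial_id_empty)
  qed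
qed

lemma hull_O3: "O3 G hull_O"
proof -
  let ?Q = "up_set G hull_O - hull_O"
  have Q: "?Q \<subseteq> idems G" by (auto simp: up_set_def)
  have up: "x \<circ>\<^sub>m y \<in> up_set G hull_O \<union> {Map.empty}"
    if xy: "x \<in> up_set G hull_O" "y \<in> up_set G hull_O" for x y
  proof -
    consider "x \<in> ?Q" "y \<in> ?Q" | b where "x \<in> ?Q" "y = q b" "b \<in> B" | b where "y \<in> ?Q" "x = q b" "b \<in> B"
      | b b' where "x = q b" "y = q b'" "b \<in> B" "b' \<in> B"
      using xy by blast
    then show ?thesis
    proof cases
      case 1 then show ?thesis using hull_upper_mult by blast
    next
      case 2 then show ?thesis using hull_upper_q[of x b] hull_O_subset_up by auto
    next
      case 3
      then have "x \<circ>\<^sub>m y = y \<circ>\<^sub>m x" using G.idems_commute[of x y] Q q_idem by auto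
      with 3 show ?thesis using hull_upper_q[of y b] hull_O_subset_up by auto
    next
      case 4 then show ?thesis
        using cyl_single_disjoint[of b b'] hull_O_subset_up
        by (cases "b = b'") (auto simp: q_def partial_id_empty)
    qed
  qed
  have upper: "x \<circ>\<^sub>m y \<in> ?Q \<union> {Map.empty}" if "x \<in> ?Q" "y \<in> ?Q" for x y
    using hull_upper_mult[OF that] by blast
  have closed: "mult_closed_set G (X \<union> {Map.empty})"
    if "\<And>x y. x \<in> X \<Longrightarrow> y \<in> X \<Longrightarrow> x \<circ>\<^sub>m y \<in> X \<union> {Map.empty}" for X
    using that unfolding mult_closed_set_def by auto
  show ?thesis
    unfolding O3_def inverse_hull_simps by (intro conjI closed) (fact up, fact upper)
qed

lemma hull_O4: "O4 G hull_O"
  unfolding O4_def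
proof (intro ballI impI)
  fix \<alpha> \<beta> assume a: "\<alpha> \<in> up_set G hull_O - hull_O" and b: "\<beta> \<in> up_set G hull_O - hull_O"
    and eq: "{e \<in> hull_O. natural_le G e \<alpha>} = {e \<in> hull_O. natural_le G e \<beta>}"
  obtain R where R: "\<alpha> = partial_id (cyl [] R)" "R \<subseteq> B" "\<alpha> \<in> idems G"
    using hull_upper_D[OF a] .
  obtain R' where R': "\<beta> = partial_id (cyl [] R')" "R' \<subseteq> B" "\<beta> \<in> idems G"
    using hull_upper_D[OF b] .
  have "c \<in> R \<longleftrightarrow> c \<in> R'" if "c \<in> B" for c
  proof -
    have "natural_le G (q c) \<alpha> \<longleftrightarrow> c \<in> R" "natural_le G (q c) \<beta> \<longleftrightarrow> c \<in> R'"
      using q_idem[OF that] R(3) R'(3) cyl_single_subset_iff[OF that] unfolding R(1) R'(1) q_def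
      by (simp_all add: natural_le_partial_id)
    then show ?thesis using eq that by blast
  qed
  then have "R = R'" using R(2) R'(2) by blast
  then show "\<alpha> = \<beta>" using R R' by simp
qed

text \<open>Both cylinders of the shape of \<open>a\<close> are prescribed, so
  \<open>cyl_inj\<close> fixes its words and its set. This settles (O5) as well as the
  alphabet.\<close>

lemma hull_letter:
  assumes a: "a \<in> carrier G" and 1: "star G a \<circ>\<^sub>m a \<in> up_set G hull_O - hull_O"
    and b: "b \<in> B" "a \<circ>\<^sub>m star G a = q b"
  shows "a = theta W [b]"
proof -
  obtain u R t where s: "shape a u R t" using hull_shape a by blast
  have RB: "R \<subseteq> B" using s by (simp add: shape_def)
  obtain R' where R': "star G a \<circ>\<^sub>m a = partial_id (cyl [] R')" "R' \<subseteq> B" "R' \<noteq> {}"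
    using hull_upper_D[OF 1] .
  have t: "cyl t R = cyl [] R'" and u: "cyl u R = cyl [b] (row b)"
    using shape_star_mult[OF a s] R' b by (simp_all add: q_def)
  have "R \<noteq> {}" 
    using t cyl_eq_empty_iff[OF RB, of t] cyl_eq_empty_iff[OF R'(2), of "[]"] R'(3) by simp
  then have "t = []" "u = [b]" "R = row b"
    using cyl_inj[OF t] cyl_inj[OF u] RB R' row_subset row_nonempty[OF b(1)] by auto
  then show ?thesis using s shape_theta[OF single_W[OF b(1)]] shape_eq by auto
qed

text \<open>If \<open>a\<close> witnesses that \<open>q b\<close> and \<open>\<alpha>\<close> are
  related, its inverse has domain \<open>\<alpha>\<close> and range \<open>q b\<close>, hence is
  \<open>theta W [b]\<close> by \<open>hull_letter\<close>; so \<open>\<alpha>\<close> is the domain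
  idempotent of that map.\<close>

lemma hull_O5: "O5 G hull_O"
proof -
  have "\<alpha> = partial_id (cyl [] (row b))"
    if D: "green_D G (q b) \<alpha>" and b: "b \<in> B" and "\<alpha> \<in> up_set G hull_O - hull_O" for b \<alpha>
  proof -
    obtain a where a: "a \<in> carrier G" "star G a \<circ>\<^sub>m a = q b" "a \<circ>\<^sub>m star G a = \<alpha>"
      using D by (auto simp: green_D_def)
    have "star G a = theta W [b]"
      using hull_letter[of "star G a" b] a that by simp
    then show ?thesis using theta_star_mult(1)[OF single_W[OF b]] a by (metis G.star_star last.simps)
  qed
  then show ?thesis unfolding O5_def by blast
qed

lemma hull_O_conditions: "O_conditions G hull_O"
  unfolding O_conditions_def
  using q_idem q_nonzero hull_O1 hull_O2 hull_O3 hull_O4 hull_O5 by auto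

text \<open>The domain and range cylinders determine the shape, and the shape determines the map;
  only the empty map has several shapes.\<close>

lemma hull_combinatorial: "combinatorial G"
  unfolding combinatorial_def
proof (intro ballI impI)
  fix f g assume f: "f \<in> carrier G" and g: "g \<in> carrier G" and H: "green_H G f g"
  obtain u R t where s: "shape f u R t" using hull_shape f by blast
  obtain u' R' t' where s': "shape g u' R' t'" using hull_shape g by blast
  have B: "R \<subseteq> B" "R' \<subseteq> B" using s s' by (auto simp: shape_def)
  have t: "cyl t R = cyl t' R'" and u: "cyl u R = cyl u' R'"
    using H shape_star_mult[OF f s] shape_star_mult[OF g s']
    by (simp_all add: green_H_def green_L_def green_R_def)
  show "f = g"
  proof (cases "R = {}")
    case True
    then have "R' = {}" 
      using t cyl_eq_empty_iff[OF B(1), of t] cyl_eq_empty_iff[OF B(2), of t'] by simp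
    then show ?thesis using True s s' by (intro map_eqI) (simp add: shape_Some)
  next
    case False
    then have "R' \<noteq> {}" 
      using t cyl_eq_empty_iff[OF B(1), of t] cyl_eq_empty_iff[OF B(2), of t'] by simp
    then show ?thesis using cyl_inj[OF t] cyl_inj[OF u] False B s s' shape_eq by auto
  qed
qed

section \<open>The language of the hull and generation\<close>

lemma hull_alphabet: "assoc_alphabet G hull_O = (\<lambda>b. theta W [b]) ` B"
proof
  show "assoc_alphabet G hull_O \<subseteq> (\<lambda>b. theta W [b]) ` B"
    using hull_letter by (auto simp: assoc_alphabet_def)
next
  have "star G (theta W [b]) \<circ>\<^sub>m theta W [b] \<in> up_set G hull_O - hull_O" if "b \<in> B" for b
    using theta_star_mult(1)[OF single_W[OF that]] G.star_mult_idem[OF theta_hull[OF single_W[OF that]]]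
      row_subset[of b] row_nonempty[OF that]
    unfolding hull_upper_iff by auto
  then show "(\<lambda>b. theta W [b]) ` B \<subseteq> assoc_alphabet G hull_O"
    using theta_star_mult(2)[OF single_W] theta_hull[OF single_W]
    by (auto simp: assoc_alphabet_def q_def)
qed

lemma theta_append: "u @ v \<in> W \<Longrightarrow> v \<in> W \<Longrightarrow> theta W u \<circ>\<^sub>m theta W v = theta W (u @ v)"
  using W_suffix by (auto intro!: map_eqI simp: map_comp_Some_iff theta_Some_iff)
    (metis append_assoc W_nonempty append_is_Nil_conv)+

text \<open>\<open>w\<close> splits into its letters by \<open>theta_append\<close>, and the map is
  not empty because the last letter of \<open>w\<close> has a successor.\<close>

lemma theta_language: assumes "w \<in> W" shows "theta W w \<in> assoc_language G hull_O"
proof -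
  have "theta W w \<in> products G (assoc_alphabet G hull_O)"
    using assms unfolding hull_alphabet
  proof (induction w rule: induct_list012)
    case 1 then show ?case using W_nonempty by blast
  next
    case (2 x) then show ?case using lang_single[OF tm] by (auto intro: products.single)
  next
    case (3 x y zs)
    have yz: "y # zs \<in> W" using W_suffix[of "[x]" "y # zs"] 3(3) by simp
    have x: "x \<in> B" using W_hd[OF 3(3)] by simp
    have "theta W [x] \<otimes>\<^bsub>G\<^esub> theta W (y # zs) \<in> products G ((\<lambda>b. theta W [b]) ` B)"
      using 3(2)[OF yz] x by (intro products.step imageI)
    then show ?case using theta_append[of "[x]" "y # zs"] 3(3) yz by simp
  qed
  moreover have "theta W w \<noteq> Map.empty"
  proof -
    obtain b where "b \<in> row (last w)" using row_nonempty[OF W_last[OF assms]] by blast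
    then have "theta W w [b] = Some (w @ [b])"
      using W_append_iff[OF assms single_W] row_subset single_W by (force simp: theta_Some_iff)
    then show ?thesis by auto
  qed
  ultimately show ?thesis by (simp add: assoc_language_def)
qed

lemma hull_generates: "generates G (assoc_language G hull_O)"
  unfolding generates_def
proof (intro ballI impI)
  let ?L = "assoc_language G hull_O"
  have star: "star (partial_bijections W) (theta W w) \<in> star G ` ?L" if "w \<in> W" for w
    using theta_language[OF that] star_inverse_hull_eq[OF theta_hull[OF that]] by (metis imageI)
  fix h assume "h \<in> carrier G" "h \<noteq> \<zero>\<^bsub>G\<^esub>"
  then have "h \<in> products (partial_bijections W) (theta W ` W \<union> star (partial_bijections W) ` theta W ` W)"
    by (simp add: inverse_hull_carrier generated_def)
  then show "h \<in> products G (?L \<union> star G ` ?L)"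
  proof (induction rule: products.induct)
    case (single x)
    then have "x \<in> ?L \<union> star G ` ?L"
      using theta_language star by blast
    then show ?case by (rule products.single)
  next
    case (step x y)
    then have "x \<in> ?L \<union> star G ` ?L"
      using theta_language star by blast
    then show ?case using products.step[OF _ step(3)] by simp
  qed
qed

end


section \<open>Transport along isomorphisms\<close>

text \<open>Every notion in the conditions is determined by the carrier and the multiplication, so a
  multiplicative bijection carries it along. \<open>G\<close> will be the hull and
  \<open>\<phi>\<close> the inverse of the given isomorphism.\<close>

locale inverse_semigroup_iso =
  G: inverse_semigroup_zero G + H: inverse_semigroup_zero H
  for G :: "('a, 'm) zero_semigroup_scheme" and H :: "('b, 'n) zero_semigroup_scheme" +
  fixes \<phi> :: "'a \<Rightarrow> 'b"
  assumes bij: "bij_betw \<phi> (carrier G) (carrier H)"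
    and hom: "\<lbrakk>x \<in> carrier G; y \<in> carrier G\<rbrakk> \<Longrightarrow> \<phi> (x \<otimes>\<^bsub>G\<^esub> y) = \<phi> x \<otimes>\<^bsub>H\<^esub> \<phi> y"
begin

lemma phi_closed [simp]: "x \<in> carrier G \<Longrightarrow> \<phi> x \<in> carrier H"
  using bij by (auto simp: bij_betw_def)

lemma phi_eq_iff: "\<lbrakk>x \<in> carrier G; y \<in> carrier G\<rbrakk> \<Longrightarrow> \<phi> x = \<phi> y \<longleftrightarrow> x = y"
  using bij by (auto simp: bij_betw_def inj_on_def)

lemma phi_surj: assumes "y \<in> carrier H" obtains x where "x \<in> carrier G" "y = \<phi> x"
  using bij assms by (auto simp: bij_betw_def)

lemma phi_zero: "\<phi> \<zero>\<^bsub>G\<^esub> = \<zero>\<^bsub>H\<^esub>"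
proof -
  obtain x where x: "x \<in> carrier G" "\<zero>\<^bsub>H\<^esub> = \<phi> x" using phi_surj[OF H.zero_closed] .
  have "\<phi> \<zero>\<^bsub>G\<^esub> \<otimes>\<^bsub>H\<^esub> \<phi> x = \<phi> \<zero>\<^bsub>G\<^esub>" using hom[of "\<zero>\<^bsub>G\<^esub>" x] x(1) by simp
  then show ?thesis using x(2) H.zero_right[of "\<phi> \<zero>\<^bsub>G\<^esub>"] by simp
qed

lemma phi_star: assumes "x \<in> carrier G" shows "star H (\<phi> x) = \<phi> (star G x)"
proof (rule H.star_unique)
  show "is_inverse H (\<phi> x) (\<phi> (star G x))"
    using G.star_is_inverse[OF assms] assms by (simp add: is_inverse_def hom[symmetric])
qed (use assms in simp)

lemma phi_idems_iff: "x \<in> carrier G \<Longrightarrow> \<phi> x \<in> idems H \<longleftrightarrow> x \<in> idems G"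
  using phi_eq_iff[of "x \<otimes>\<^bsub>G\<^esub> x" x] phi_closed[of x] hom[of x x] G.mult_closed[of x x]
  unfolding idems_def by simp

lemma idems_image: "idems H = \<phi> ` idems G"
proof
  show "idems H \<subseteq> \<phi> ` idems G"
  proof
    fix y assume y: "y \<in> idems H"
    then obtain x where "x \<in> carrier G" "y = \<phi> x" using phi_surj[of y] by blast
    then show "y \<in> \<phi> ` idems G" using phi_idems_iff y by blast
  qed
qed (use phi_idems_iff G.idems_closed in blast)

lemma phi_natural_le:
  assumes "x \<in> carrier G" "y \<in> carrier G"
  shows "natural_le H (\<phi> x) (\<phi> y) \<longleftrightarrow> natural_le G x y"
proof -
  have "\<phi> x = \<phi> y \<otimes>\<^bsub>H\<^esub> \<phi> e \<longleftrightarrow> x = y \<otimes>\<^bsub>G\<^esub> e" if "e \<in> idems G" for e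
    using that assms by (simp add: hom[symmetric] phi_eq_iff)
  then show ?thesis unfolding natural_le_def idems_image by blast
qed

lemma image_diff:
  "\<lbrakk>X \<subseteq> carrier G; Y \<subseteq> carrier G\<rbrakk> \<Longrightarrow> \<phi> ` X - \<phi> ` Y = \<phi> ` (X - Y)"
  using bij inj_on_image_set_diff[of \<phi> "carrier G" X Y] by (auto simp: bij_betw_def)

lemma up_set_subset: "up_set G \<O> \<subseteq> carrier G"
  by (auto simp: up_set_def)

lemma up_set_image:
  assumes "\<O> \<subseteq> carrier G"
  shows "up_set H (\<phi> ` \<O>) = \<phi> ` up_set G \<O>"
proof -
  have "(\<exists>e\<in>\<phi> ` \<O>. natural_le H e (\<phi> x)) \<longleftrightarrow> (\<exists>e\<in>\<O>. natural_le G e x)" if "x \<in> idems G" for x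
    using phi_natural_le assms that by (auto simp: subset_eq)
  then show ?thesis unfolding up_set_def idems_image by blast
qed

lemma up_set_diff_image:
  "\<O> \<subseteq> carrier G \<Longrightarrow> up_set H (\<phi> ` \<O>) - \<phi> ` \<O> = \<phi> ` (up_set G \<O> - \<O>)"
  using up_set_image image_diff up_set_subset by metis

lemma mult_closed_set_image:
  assumes "X \<subseteq> carrier G" "mult_closed_set G (X \<union> {\<zero>\<^bsub>G\<^esub>})"
  shows "mult_closed_set H (\<phi> ` X \<union> {\<zero>\<^bsub>H\<^esub>})"
proof -
  have eq: "\<phi> ` X \<union> {\<zero>\<^bsub>H\<^esub>} = \<phi> ` (X \<union> {\<zero>\<^bsub>G\<^esub>})" by (simp add: phi_zero)
  have "X \<union> {\<zero>\<^bsub>G\<^esub>} \<subseteq> carrier G" using assms(1) by simp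
  with assms(2) show ?thesis unfolding eq mult_closed_set_def
    by (auto simp: hom[symmetric] subset_eq simp del: Un_insert_right)
qed

lemma phi_green_D:
  assumes "x \<in> carrier G" "y \<in> carrier G" "green_D H (\<phi> x) (\<phi> y)"
  shows "green_D G x y"
proof -
  obtain b where b: "b \<in> carrier H" "star H b \<otimes>\<^bsub>H\<^esub> b = \<phi> x" "b \<otimes>\<^bsub>H\<^esub> star H b = \<phi> y"
    using assms(3) by (auto simp: green_D_def)
  obtain a where a: "a \<in> carrier G" "b = \<phi> a" using phi_surj[OF b(1)] .
  then have "star G a \<otimes>\<^bsub>G\<^esub> a = x" "a \<otimes>\<^bsub>G\<^esub> star G a = y"
    using b assms phi_eq_iff by (simp_all add: phi_star hom[symmetric])
  then show ?thesis using a(1) by (auto simp: green_D_def)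
qed

lemma combinatorial_image: assumes "combinatorial G" shows "combinatorial H"
  unfolding combinatorial_def
proof (intro ballI impI)
  fix s t assume "s \<in> carrier H" "t \<in> carrier H" and H: "green_H H s t"
  then obtain x y where xy: "x \<in> carrier G" "s = \<phi> x" "y \<in> carrier G" "t = \<phi> y"
    using phi_surj by metis
  then have "green_H G x y"
    using H phi_eq_iff
    by (simp add: green_H_def green_L_def green_R_def phi_star hom[symmetric])
  then show "s = t" using assms xy unfolding combinatorial_def by blast
qed

lemma O_conditions_image: assumes "O_conditions G \<O>" shows "O_conditions H (\<phi> ` \<O>)"
proof -
  have sub: "\<O> \<subseteq> idems G" and nz: "\<zero>\<^bsub>G\<^esub> \<notin> \<O>" using assms by (auto simp: O_conditions_def)
  have C: "\<O> \<subseteq> carrier G" using sub by blast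
  have Q: "up_set G \<O> - \<O> \<subseteq> carrier G" using up_set_subset by blast
  note up = up_set_image[OF C] up_set_diff_image[OF C]
  have 0: "\<phi> ` \<O> \<subseteq> idems H - {\<zero>\<^bsub>H\<^esub>}"
    using sub nz C phi_eq_iff[OF _ G.zero_closed] idems_image by (auto simp: phi_zero[symmetric])
  have 1: "O1 H (\<phi> ` \<O>)"
    using assms C by (auto simp: O_conditions_def O1_def hom[symmetric] phi_zero[symmetric] subset_eq)
      metis
  have 2: "O2 H (\<phi> ` \<O>)"
    using assms C unfolding O_conditions_def O2_def idems_image
    by (simp add: phi_natural_le G.idems_closed subset_eq)
  have 3: "O3 H (\<phi> ` \<O>)"
    using assms mult_closed_set_image[OF up_set_subset] mult_closed_set_image[OF Q]
    unfolding O_conditions_def O3_def up(2) unfolding up(1) by simp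
  have 4: "O4 H (\<phi> ` \<O>)"
    unfolding O4_def up(2)
  proof (intro ballI impI, elim imageE)
    fix \<alpha> \<beta> x y
    assume eq: "{e \<in> \<phi> ` \<O>. natural_le H e \<alpha>} = {e \<in> \<phi> ` \<O>. natural_le H e \<beta>}"
      and xy: "\<alpha> = \<phi> x" "x \<in> up_set G \<O> - \<O>" "\<beta> = \<phi> y" "y \<in> up_set G \<O> - \<O>"
    have "natural_le G e x \<longleftrightarrow> natural_le G e y" if "e \<in> \<O>" for e
      using that C Q xy phi_natural_le[of e x] phi_natural_le[of e y] eq by blast
    then have "{e \<in> \<O>. natural_le G e x} = {e \<in> \<O>. natural_le G e y}" by blast
    then have "x = y" using assms xy unfolding O_conditions_def O4_def by blast
    then show "\<alpha> = \<beta>" using xy by simp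
  qed
  have 5: "O5 H (\<phi> ` \<O>)"
    unfolding O5_def up(2)
  proof (intro ballI impI, elim imageE conjE)
    fix e \<alpha> \<beta> e' x y
    assume D: "green_D H e \<alpha>" "green_D H e \<beta>" and e: "e = \<phi> e'" "e' \<in> \<O>"
      and xy: "\<alpha> = \<phi> x" "x \<in> up_set G \<O> - \<O>" "\<beta> = \<phi> y" "y \<in> up_set G \<O> - \<O>"
    have "green_D G e' x" "green_D G e' y" using D e xy C Q phi_green_D by blast+
    then have "x = y" using assms e xy unfolding O_conditions_def O5_def by blast
    then show "\<alpha> = \<beta>" using xy by simp
  qed
  show ?thesis using 0 1 2 3 4 5 by (simp add: O_conditions_def)
qed

lemma assoc_alphabet_image:
  assumes "\<O> \<subseteq> carrier G"
  shows "assoc_alphabet H (\<phi> ` \<O>) = \<phi> ` assoc_alphabet G \<O>"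
proof -
  have mem: "\<phi> z \<in> \<phi> ` Y \<longleftrightarrow> z \<in> Y" if "z \<in> carrier G" "Y \<subseteq> carrier G" for z Y
    using that phi_eq_iff by blast
  have Q: "up_set G \<O> - \<O> \<subseteq> carrier G" using up_set_subset by blast
  have iff: "\<phi> x \<in> assoc_alphabet H (\<phi> ` \<O>) \<longleftrightarrow> x \<in> assoc_alphabet G \<O>" if "x \<in> carrier G" for x
    using that mem[OF _ Q, of "star G x \<otimes>\<^bsub>G\<^esub> x"] mem[OF _ assms, of "x \<otimes>\<^bsub>G\<^esub> star G x"]
    unfolding assoc_alphabet_def up_set_diff_image[OF assms]
    by (simp add: phi_star hom[symmetric])
  show ?thesis
  proof
    show "assoc_alphabet H (\<phi> ` \<O>) \<subseteq> \<phi> ` assoc_alphabet G \<O>"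
    proof
      fix y assume y: "y \<in> assoc_alphabet H (\<phi> ` \<O>)"
      then obtain x where "x \<in> carrier G" "y = \<phi> x" using phi_surj[of y] by (auto simp: assoc_alphabet_def)
      then show "y \<in> \<phi> ` assoc_alphabet G \<O>" using iff y by blast
    qed
    have "assoc_alphabet G \<O> \<subseteq> carrier G" by (auto simp: assoc_alphabet_def)
    then show "\<phi> ` assoc_alphabet G \<O> \<subseteq> assoc_alphabet H (\<phi> ` \<O>)" using iff by blast
  qed
qed

lemma phi_products:
  assumes "x \<in> products G X" "X \<subseteq> carrier G"
  shows "\<phi> x \<in> products H (\<phi> ` X)"
  using assms(1)
proof (induction rule: products.induct)
  case (step x y)
  have "y \<in> carrier G" "x \<in> carrier G"
    using G.products_closed[OF assms(2)] step assms(2) by auto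
  then show ?case using step by (simp add: hom products.step)
qed (auto intro: products.single)

lemma products_mono: "\<lbrakk>x \<in> products K X; X \<subseteq> Y\<rbrakk> \<Longrightarrow> x \<in> products K Y"
  by (induction rule: products.induct) (auto intro: products.intros)

lemma generates_image:
  assumes "\<O> \<subseteq> carrier G" "generates G (assoc_language G \<O>)"
  shows "generates H (assoc_language H (\<phi> ` \<O>))"
  unfolding generates_def
proof (intro ballI impI)
  let ?L = "assoc_language G \<O>" and ?L' = "assoc_language H (\<phi> ` \<O>)"
  fix y assume y: "y \<in> carrier H" "y \<noteq> \<zero>\<^bsub>H\<^esub>"
  obtain x where x: "x \<in> carrier G" "y = \<phi> x" using phi_surj[OF y(1)] .
  have A: "assoc_alphabet G \<O> \<subseteq> carrier G" by (auto simp: assoc_alphabet_def)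
  have L: "?L \<subseteq> carrier G"
    using G.products_closed[OF A] by (auto simp: assoc_language_def)
  have "x \<in> products G (?L \<union> star G ` ?L)"
    using assms(2) x y phi_zero by (auto simp: generates_def)
  then have 1: "y \<in> products H (\<phi> ` (?L \<union> star G ` ?L))"
    using phi_products L x by blast
  \<comment> \<open>An inclusion of the generating sets suffices, by
    \<open>products_mono\<close>.\<close>
  have 2: "\<phi> ` ?L \<subseteq> ?L'"
    using phi_products[OF _ A] L phi_eq_iff[OF _ G.zero_closed]
    by (auto simp: assoc_language_def assoc_alphabet_image[OF assms(1)] phi_zero[symmetric])
  have "\<phi> ` star G ` ?L \<subseteq> star H ` ?L'"
  proof
    fix z assume "z \<in> \<phi> ` star G ` ?L"
    then obtain w where "w \<in> ?L" "z = \<phi> (star G w)" by blast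
    then show "z \<in> star H ` ?L'" using 2 L phi_star[of w] by (metis imageI subsetD)
  qed
  with 2 have "\<phi> ` (?L \<union> star G ` ?L) \<subseteq> ?L' \<union> star H ` ?L'" by blast
  with 1 show "y \<in> products H (?L' \<union> star H ` ?L')" by (rule products_mono)
qed

end


section \<open>From the conditions to a Markov subshift\<close>

text \<open>\<open>B\<close> and \<open>c\<close> stay abstract so that one construction serves both
  equivalences: \<open>c\<close> enumerates the alphabet by numbers, or is the identity on
  it.\<close>

locale markov_semigroup = inverse_semigroup_zero H
  for H :: "('a, 'm) zero_semigroup_scheme" (structure) +
  fixes \<O> :: "'a set" and B :: "'b set" and c :: "'b \<Rightarrow> 'a"
  assumes comb: "combinatorial H"
    and conds: "O_conditions H \<O>"
    and gen: "generates H (assoc_language H \<O>)"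
    and letters: "bij_betw c B (assoc_alphabet H \<O>)"
begin

abbreviation "Q \<equiv> up_set H \<O> - \<O>"

section \<open>Letters, the set \<open>Q\<close> and normal forms\<close>

lemma O_idem: "e \<in> \<O> \<Longrightarrow> e \<in> idems H" and O_nonzero: "\<zero> \<notin> \<O>"
  and orth: "\<lbrakk>e \<in> \<O>; f \<in> \<O>; e \<otimes> f \<noteq> \<zero>\<rbrakk> \<Longrightarrow> e = f"
  using conds by (auto simp: O_conditions_def O1_def)

lemma Q_idem: "\<alpha> \<in> Q \<Longrightarrow> \<alpha> \<in> idems H"
  by (simp add: up_set_def)

lemma Q_closed [simp, intro]: "\<alpha> \<in> Q \<Longrightarrow> \<alpha> \<in> carrier H"
  using Q_idem by blast

lemma O_closed [simp, intro]: "e \<in> \<O> \<Longrightarrow> e \<in> carrier H"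
  using O_idem by blast

lemma up_iff: "\<alpha> \<in> idems H \<Longrightarrow> \<alpha> \<in> up_set H \<O> \<longleftrightarrow> (\<exists>e\<in>\<O>. \<alpha> \<otimes> e = e)"
  using natural_le_idems[OF O_idem] by (auto simp: up_set_def)

lemma O_up: "e \<in> \<O> \<Longrightarrow> e \<in> up_set H \<O>"
  using up_iff[OF O_idem] idems_mult_self[OF O_idem] by blast

lemma Q_above: assumes "\<alpha> \<in> Q" obtains e where "e \<in> \<O>" "\<alpha> \<otimes> e = e"
  using assms up_iff[OF Q_idem[OF assms]] by blast

lemma Q_nonzero: "\<alpha> \<in> Q \<Longrightarrow> \<alpha> \<noteq> \<zero>"
  using Q_above O_nonzero by (metis O_closed zero_left)

lemma Q_mult: "\<lbrakk>\<alpha> \<in> Q; \<beta> \<in> Q; \<alpha> \<otimes> \<beta> \<noteq> \<zero>\<rbrakk> \<Longrightarrow> \<alpha> \<otimes> \<beta> \<in> Q"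
  and up_mult: "\<lbrakk>\<alpha> \<in> up_set H \<O>; \<beta> \<in> up_set H \<O>; \<alpha> \<otimes> \<beta> \<noteq> \<zero>\<rbrakk> \<Longrightarrow> \<alpha> \<otimes> \<beta> \<in> up_set H \<O>"
  using conds unfolding O_conditions_def O3_def mult_closed_set_def by blast+

text \<open>\<open>\<alpha>\<close> lies above some \<open>e\<close> of \<open>\<O>\<close>, and
  then so does \<open>f\<close>; orthogonality gives \<open>f = e\<close>, hence
  \<open>\<alpha> = f\<close>, which is not in \<open>Q\<close>. An element that begins with a
  letter is thus never in \<open>Q\<close>.\<close>

lemma Q_not_below_O:
  assumes "\<alpha> \<in> Q" "f \<in> \<O>" "f \<otimes> \<alpha> = \<alpha>" shows False
proof -
  obtain e where e: "e \<in> \<O>" "\<alpha> \<otimes> e = e" using Q_above assms(1) .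
  have "f \<otimes> e = (f \<otimes> \<alpha>) \<otimes> e" using e assms(1,2) by (simp add: mult_assoc)
  then have "f \<otimes> e = e" using assms(3) e by simp
  then have "f = e" using orth[OF assms(2) e(1)] e O_nonzero by metis
  then have "f \<otimes> \<alpha> = f" using e idems_commute[OF O_idem[OF assms(2)] Q_idem[OF assms(1)]] by simp
  then show False using assms by simp
qed

text \<open>By (O3) a nonzero \<open>\<alpha> \<otimes> e\<close> lies above some \<open>f\<close>
  of \<open>\<O>\<close>; this \<open>f\<close> is not orthogonal to \<open>e\<close>, so (O1) gives
  \<open>f = e\<close>.\<close>

lemma Q_O: assumes "\<alpha> \<in> Q" "e \<in> \<O>" "\<alpha> \<otimes> e \<noteq> \<zero>" shows "\<alpha> \<otimes> e = e"
proof -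
  have i: "\<alpha> \<otimes> e \<in> idems H" using assms Q_idem O_idem idems_mult by blast
  have "\<alpha> \<otimes> e \<in> up_set H \<O>" using up_mult[of \<alpha> e] assms O_up by blast
  then obtain f where f: "f \<in> \<O>" "\<alpha> \<otimes> e \<otimes> f = f" using up_iff[OF i] by blast
  have "e \<otimes> f \<noteq> \<zero>"
    using f assms O_nonzero by (metis O_closed Q_closed mult_assoc zero_right)
  then have "e = f" using orth assms(2) f(1) by blast
  then show ?thesis using f assms idems_mult_self[OF O_idem[OF assms(2)]] by (simp add: mult_assoc)
qed

lemma letter_mem: "b \<in> B \<Longrightarrow> c b \<in> assoc_alphabet H \<O>"
  using letters by (auto simp: bij_betw_def)

lemma letter_closed [simp, intro]: "b \<in> B \<Longrightarrow> c b \<in> carrier H"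
  and letter_Q: "b \<in> B \<Longrightarrow> (c b)\<^sup>\<star> \<otimes> c b \<in> Q"
  and letter_O: "b \<in> B \<Longrightarrow> c b \<otimes> (c b)\<^sup>\<star> \<in> \<O>"
  using letter_mem by (auto simp: assoc_alphabet_def)

lemma letter_nonzero: "b \<in> B \<Longrightarrow> c b \<noteq> \<zero>"
  using letter_O[of b] O_nonzero by auto

lemma letter_inj: "\<lbrakk>a \<in> B; b \<in> B; c a = c b\<rbrakk> \<Longrightarrow> a = b"
  using letters by (auto simp: bij_betw_def inj_on_def)

lemma Q_letter: assumes "\<alpha> \<in> Q" "b \<in> B" "\<alpha> \<otimes> c b \<noteq> \<zero>" shows "\<alpha> \<otimes> c b = c b"
proof -
  have eq: "\<alpha> \<otimes> c b = (\<alpha> \<otimes> (c b \<otimes> (c b)\<^sup>\<star>)) \<otimes> c b" using assms by (simp add: mult_assoc)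
  then have "\<alpha> \<otimes> (c b \<otimes> (c b)\<^sup>\<star>) \<noteq> \<zero>" using assms by auto
  then show ?thesis using Q_O[OF assms(1) letter_O[OF assms(2)]] eq assms by (simp add: mult_assoc)
qed

text \<open>If \<open>a\<^sup>\<star>b \<noteq> 0\<close> then \<open>a\<close> and \<open>b\<close> have the same range idempotent, hence by (O5) the same domain
  idempotent, so they are equal because \<open>H\<close> is combinatorial.\<close>

lemma letter_orth: assumes "a \<in> B" "b \<in> B" "(c a)\<^sup>\<star> \<otimes> c b \<noteq> \<zero>" shows "a = b"
proof -
  let ?e = "c a \<otimes> (c a)\<^sup>\<star>" and ?f = "c b \<otimes> (c b)\<^sup>\<star>"
  have "(c a)\<^sup>\<star> \<otimes> c b = (c a)\<^sup>\<star> \<otimes> (?e \<otimes> ?f) \<otimes> c b" using assms by (simp add: mult_assoc)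
  then have "?e \<otimes> ?f \<noteq> \<zero>" using assms by auto
  then have ef: "?e = ?f" using orth letter_O assms by blast
  \<comment> \<open>\<open>green_D\<close> takes the first idempotent as the domain, so the
    witnesses are the inverses of the letters.\<close>
  have "green_D H ?e ((c a)\<^sup>\<star> \<otimes> c a)" "green_D H ?f ((c b)\<^sup>\<star> \<otimes> c b)"
    unfolding green_D_def
    using assms bexI[of _ "(c a)\<^sup>\<star>"] bexI[of _ "(c b)\<^sup>\<star>"] by auto
  then have "(c a)\<^sup>\<star> \<otimes> c a = (c b)\<^sup>\<star> \<otimes> c b"
    using conds letter_O[OF assms(1)] letter_Q[OF assms(1)] letter_Q[OF assms(2)] ef
    unfolding O_conditions_def O5_def by metis
  then have "green_H H (c a) (c b)" using ef by (simp add: green_H_def green_L_def green_R_def)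
  then have "c a = c b" using comb assms letter_closed unfolding combinatorial_def by blast
  then show ?thesis using letter_inj assms by blast
qed

text \<open>A word acts on an element instead of being multiplied out, since \<open>H\<close> need
  not have an identity to stand for the empty word.\<close>

definition act :: "'b list \<Rightarrow> 'a \<Rightarrow> 'a" where "act v x = foldr (\<lambda>b y. c b \<otimes> y) v x"

lemma act_simps [simp]: "act [] x = x" "act (b # v) x = c b \<otimes> act v x"
  and act_append: "act (u @ v) x = act u (act v x)"
  by (simp_all add: act_def)

lemma act_closed [simp, intro]: "\<lbrakk>set v \<subseteq> B; x \<in> carrier H\<rbrakk> \<Longrightarrow> act v x \<in> carrier H"
  by (induction v) auto

lemma act_mult: "\<lbrakk>set v \<subseteq> B; x \<in> carrier H; y \<in> carrier H\<rbrakk> \<Longrightarrow> act v (x \<otimes> y) = act v x \<otimes> y"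
  by (induction v) (auto simp: mult_assoc)

lemma act_zero [simp]: "set v \<subseteq> B \<Longrightarrow> act v \<zero> = \<zero>"
  by (induction v) auto

text \<open>The first letter of \<open>v\<close> decides, by \<open>Q_letter\<close>. With an empty
  word \<open>\<alpha>\<close> could restrict \<open>x\<close> properly, so later arguments treat
  that case apart.\<close>

lemma act_absorb:
  assumes "\<alpha> \<in> Q" "v \<noteq> []" "set v \<subseteq> B" "x \<in> carrier H" "\<alpha> \<otimes> act v x \<noteq> \<zero>"
  shows "\<alpha> \<otimes> act v x = act v x"
proof -
  obtain b u where v: "v = b # u" using assms(2) by (cases v) auto
  have eq: "\<alpha> \<otimes> act v x = (\<alpha> \<otimes> c b) \<otimes> act u x" using assms v by (simp add: mult_assoc)
  then have "\<alpha> \<otimes> c b \<noteq> \<zero>" using assms v by auto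
  then have "\<alpha> \<otimes> c b = c b" using Q_letter assms v by simp
  then show ?thesis using eq v by simp
qed

lemma letter_mult_eq_zero:
  assumes "a \<in> B" "x \<in> carrier H"
  shows "(c a)\<^sup>\<star> \<otimes> (c a \<otimes> x) = \<zero> \<longleftrightarrow> c a \<otimes> x = \<zero>"
  using assms by (metis letter_closed mult_closed mult_star_mult_assoc(1) star_closed zero_right)

lemma star_letter_act:
  assumes "a \<in> B" "v \<noteq> []" "set v \<subseteq> B" "x \<in> carrier H" "c a \<otimes> act v x \<noteq> \<zero>"
  shows "(c a)\<^sup>\<star> \<otimes> (c a \<otimes> act v x) = act v x"
  using act_absorb[OF letter_Q[OF assms(1)] assms(2-4)] letter_mult_eq_zero[OF assms(1), of "act v x"] assms
  by (simp add: mult_assoc)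

text \<open>Every letter but the last cancels against its inverse by \<open>star_letter_act\<close>;
  only the domain idempotent of the last letter survives, just as the domain of
  \<open>theta W w\<close> depends only on \<open>last w\<close>.\<close>

lemma act_star_mult:
  assumes "set v \<subseteq> B" "a \<in> B" "x \<in> carrier H" "act (v @ [a]) x \<noteq> \<zero>"
  shows "(act (v @ [a]) x)\<^sup>\<star> \<otimes> act (v @ [a]) x = x\<^sup>\<star> \<otimes> (((c a)\<^sup>\<star> \<otimes> c a) \<otimes> x)"
  using assms
proof (induction v)
  case Nil then show ?case by (simp add: star_mult mult_assoc)
next
  case (Cons d v)
  let ?y = "act (v @ [a]) x"
  have y: "?y \<in> carrier H" using Cons by auto
  have d: "d \<in> B" using Cons by simp
  have nz: "c d \<otimes> ?y \<noteq> \<zero>" using Cons by simp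
  then have "?y \<noteq> \<zero>" using d by auto
  have "(c d)\<^sup>\<star> \<otimes> (c d \<otimes> ?y) = ?y" using star_letter_act[of d "v @ [a]" x] Cons nz by simp
  then show ?case using Cons.IH Cons.prems \<open>?y \<noteq> \<zero>\<close> y d by (simp add: star_mult mult_assoc)
qed

lemma act_star_mult_Q:
  assumes "set v \<subseteq> B" "\<alpha> \<in> Q" "act v \<alpha> \<noteq> \<zero>"
  shows "(act v \<alpha>)\<^sup>\<star> \<otimes> act v \<alpha> \<in> Q"
proof (cases v rule: rev_cases)
  case Nil
  then show ?thesis using assms idems_star[OF Q_idem] idems_mult_self[OF Q_idem] by simp
next
  case (snoc u a)
  let ?\<delta> = "(c a)\<^sup>\<star> \<otimes> c a"
  have a: "a \<in> B" "set u \<subseteq> B" using snoc assms by auto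
  have eq: "(act v \<alpha>)\<^sup>\<star> \<otimes> act v \<alpha> = \<alpha> \<otimes> (?\<delta> \<otimes> \<alpha>)"
    using act_star_mult[of u a \<alpha>] assms a snoc idems_star[OF Q_idem] by simp
  have c: "?\<delta> \<otimes> \<alpha> = \<alpha> \<otimes> ?\<delta>" using idems_commute Q_idem assms(2) letter_Q[OF a(1)] by blast
  have "(act v \<alpha>)\<^sup>\<star> \<otimes> act v \<alpha> = \<alpha> \<otimes> ?\<delta>"
    unfolding eq c using assms a idems_mult_self_assoc[OF Q_idem[OF assms(2)], of ?\<delta>] by simp
  moreover have "(act v \<alpha>)\<^sup>\<star> \<otimes> act v \<alpha> \<noteq> \<zero>"
    using star_mult_eq_zero_iff[of "act v \<alpha>"] assms by simp
  ultimately show ?thesis using Q_mult[OF assms(2) letter_Q[OF a(1)]] by simp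
qed

text \<open>\<open>\<gamma>\<close> is idempotent, so this is
  \<open>u \<gamma> t\<^sup>\<star>\<close>; carrying \<open>\<gamma>\<close> on both sides keeps
  the expression meaningful when either word is empty.\<close>

definition normal :: "'a set" where
  "normal = {h. h = \<zero> \<or> (\<exists>u t \<gamma>. set u \<subseteq> B \<and> set t \<subseteq> B \<and> \<gamma> \<in> Q \<and> h = act u \<gamma> \<otimes> (act t \<gamma>)\<^sup>\<star>)}"

lemma normalI:
  "\<lbrakk>set u \<subseteq> B; set t \<subseteq> B; \<gamma> \<in> Q; h = act u \<gamma> \<otimes> (act t \<gamma>)\<^sup>\<star>\<rbrakk> \<Longrightarrow> h \<in> normal"
  unfolding normal_def by blast

lemma zero_normal: "\<zero> \<in> normal"
  by (simp add: normal_def)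

lemma normal_closed: "h \<in> normal \<Longrightarrow> h \<in> carrier H"
  unfolding normal_def by auto

lemma letter_normal: assumes "a \<in> B" shows "c a \<in> normal" "(c a)\<^sup>\<star> \<in> normal"
proof -
  have i: "((c a)\<^sup>\<star> \<otimes> c a)\<^sup>\<star> = (c a)\<^sup>\<star> \<otimes> c a" using idems_star star_mult_idem assms by blast
  show "c a \<in> normal"
    by (rule normalI[of "[a]" "[]" "(c a)\<^sup>\<star> \<otimes> c a"]) (use assms letter_Q i in \<open>auto simp: mult_assoc\<close>)
  show "(c a)\<^sup>\<star> \<in> normal"
    by (rule normalI[of "[]" "[a]" "(c a)\<^sup>\<star> \<otimes> c a"])
      (use assms letter_Q in \<open>auto simp: mult_assoc star_mult\<close>)
qed

lemma letter_mult_normal: assumes "a \<in> B" "h \<in> normal" shows "c a \<otimes> h \<in> normal"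
proof (cases "h = \<zero>")
  case False
  then obtain u t \<gamma> where "set u \<subseteq> B" "set t \<subseteq> B" "\<gamma> \<in> Q" "h = act u \<gamma> \<otimes> (act t \<gamma>)\<^sup>\<star>"
    using assms(2) unfolding normal_def by blast
  then show ?thesis by (intro normalI[of "a # u" t \<gamma>]) (use assms in \<open>auto simp: mult_assoc\<close>)
qed (use assms zero_normal in simp)

lemma star_act_mult:
  assumes "set t \<subseteq> B" "\<gamma> \<in> Q" "\<delta> \<in> idems H"
  shows "(act t (\<gamma> \<otimes> \<delta>))\<^sup>\<star> = \<delta> \<otimes> (act t \<gamma>)\<^sup>\<star>"
proof -
  have "\<delta> \<in> carrier H" using assms by blast
  then show ?thesis using assms by (simp add: act_mult star_mult idems_star)
qed

text \<open>If \<open>u\<close> is empty, \<open>a\<close> is appended to \<open>t\<close>.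
  Otherwise its first letter must be \<open>a\<close> by \<open>letter_orth\<close> and cancels,
  leaving the domain idempotent of \<open>a\<close>, which the next letter absorbs or, when none is
  left, which is multiplied into \<open>\<gamma>\<close>.\<close>

lemma star_letter_mult_normal: assumes "a \<in> B" "h \<in> normal" shows "(c a)\<^sup>\<star> \<otimes> h \<in> normal"
proof (cases "(c a)\<^sup>\<star> \<otimes> h = \<zero>")
  case False
  let ?\<delta> = "(c a)\<^sup>\<star> \<otimes> c a"
  have "h \<noteq> \<zero>" using False assms by auto
  then obtain u t \<gamma> where h: "set u \<subseteq> B" "set t \<subseteq> B" "\<gamma> \<in> Q" "h = act u \<gamma> \<otimes> (act t \<gamma>)\<^sup>\<star>"
    using assms(2) unfolding normal_def by blast
  have \<gamma>: "\<gamma> \<in> carrier H" "\<gamma> \<otimes> \<gamma> = \<gamma>" "\<gamma>\<^sup>\<star> = \<gamma>"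
    using h idems_mult_self[OF Q_idem] idems_star[OF Q_idem] by auto
  have \<delta>: "?\<delta> \<in> Q" "?\<delta> \<in> idems H" "?\<delta> \<in> carrier H" using letter_Q assms by auto
  have A: "act u \<gamma> \<in> carrier H" "act t \<gamma> \<in> carrier H" "(act t \<gamma>)\<^sup>\<star> \<in> carrier H" using h by auto
  show ?thesis
  proof (cases u)
    case Nil
    then have h': "h = \<gamma> \<otimes> (act t \<gamma>)\<^sup>\<star>" using h by simp
    have "(c a)\<^sup>\<star> \<otimes> \<gamma> \<noteq> \<zero>" using False assms(1) \<gamma> A unfolding h' by (auto simp: mult_assoc[symmetric])
    moreover have s: "(\<gamma> \<otimes> c a)\<^sup>\<star> = (c a)\<^sup>\<star> \<otimes> \<gamma>" using assms(1) \<gamma> by (simp add: star_mult)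
    ultimately have "\<gamma> \<otimes> c a \<noteq> \<zero>" by auto
    then have ga: "\<gamma> \<otimes> c a = c a" using Q_letter h assms(1) by blast
    then have "(c a)\<^sup>\<star> \<otimes> \<gamma> = (c a)\<^sup>\<star>" using s by simp
    then have "(c a)\<^sup>\<star> \<otimes> h = (c a)\<^sup>\<star> \<otimes> (act t \<gamma>)\<^sup>\<star>"
      unfolding h' using assms(1) \<gamma> A by (simp add: mult_assoc[symmetric])
    also have "\<dots> = (act t (\<gamma> \<otimes> c a))\<^sup>\<star>" using assms(1) \<gamma> A h by (simp add: star_mult act_mult)
    also have "\<dots> = (act t (c a))\<^sup>\<star>" using ga by simp
    \<comment> \<open>One copy of \<open>?\<delta>\<close> becomes the middle idempotent, the other
      stays inside the word that ends in \<open>a\<close>.\<close>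
    also have "\<dots> = (act t (c a \<otimes> ?\<delta>))\<^sup>\<star>" using assms(1) by (simp add: mult_assoc)
    also have "\<dots> = (act t (c a) \<otimes> ?\<delta>)\<^sup>\<star>" using assms(1) h by (subst act_mult) auto
    also have "\<dots> = ?\<delta> \<otimes> (act t (c a) \<otimes> ?\<delta>)\<^sup>\<star>"
      using assms(1) h \<delta> by (simp add: star_mult idems_star idems_mult_self_assoc del: mult_star_mult)
    also have "\<dots> = ?\<delta> \<otimes> (act (t @ [a]) ?\<delta>)\<^sup>\<star>" using assms(1) h by (simp add: act_append act_mult[symmetric])
    finally show ?thesis by (intro normalI[of "[]" "t @ [a]" ?\<delta>]) (use h assms(1) \<delta> in auto)
  next
    case (Cons d u')
    have d: "d \<in> B" "set u' \<subseteq> B" using h Cons by auto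
    have A': "act u' \<gamma> \<in> carrier H" using d \<gamma> by auto
    have eq: "(c a)\<^sup>\<star> \<otimes> h = ((c a)\<^sup>\<star> \<otimes> c d) \<otimes> (act u' \<gamma> \<otimes> (act t \<gamma>)\<^sup>\<star>)"
      using assms(1) h d A A' Cons by (simp add: mult_assoc)
    then have "(c a)\<^sup>\<star> \<otimes> c d \<noteq> \<zero>" using False A A' by auto
    then have ad: "d = a" using letter_orth assms(1) d(1) by blast
    have eq: "(c a)\<^sup>\<star> \<otimes> h = (?\<delta> \<otimes> act u' \<gamma>) \<otimes> (act t \<gamma>)\<^sup>\<star>"
      using eq A A' assms(1) unfolding ad by (simp add: mult_assoc)
    then have nz: "?\<delta> \<otimes> act u' \<gamma> \<noteq> \<zero>" using False A by auto
    show ?thesis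
    proof (cases "u' = []")
      case False
      then have "?\<delta> \<otimes> act u' \<gamma> = act u' \<gamma>" using act_absorb[OF \<delta>(1) _ d(2) \<gamma>(1)] nz by blast
      then show ?thesis using eq by (intro normalI[of u' t \<gamma>]) (use h d in auto)
    next
      case True
      have nz: "?\<delta> \<otimes> \<gamma> \<noteq> \<zero>" using nz True by simp
      have c: "?\<delta> \<otimes> \<gamma> = \<gamma> \<otimes> ?\<delta>" using idems_commute[OF \<delta>(2) Q_idem[OF h(3)]] .
      have "(c a)\<^sup>\<star> \<otimes> h = (\<gamma> \<otimes> ?\<delta>) \<otimes> (act t \<gamma>)\<^sup>\<star>" using eq True c by simp
      also have "\<dots> = (\<gamma> \<otimes> ?\<delta>) \<otimes> (?\<delta> \<otimes> (act t \<gamma>)\<^sup>\<star>)"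
        using \<gamma> A assms(1) by (simp add: mult_assoc)
      also have "\<dots> = (\<gamma> \<otimes> ?\<delta>) \<otimes> (act t (\<gamma> \<otimes> ?\<delta>))\<^sup>\<star>" using star_act_mult[OF h(2,3) \<delta>(2)] by simp
      finally show ?thesis
        using Q_mult[OF \<delta>(1) h(3) nz] h unfolding c by (intro normalI[of "[]" t "\<gamma> \<otimes> ?\<delta>"]) auto
    qed
  qed
qed (use zero_normal in simp)

lemma alphabet_letter: assumes "x \<in> assoc_alphabet H \<O>" obtains b where "b \<in> B" "x = c b"
  using letters assms by (auto simp: bij_betw_def)

lemma alphabet_closed: "assoc_alphabet H \<O> \<subseteq> carrier H"
  by (auto simp: assoc_alphabet_def)

lemma alphabet_products_closed: "products H (assoc_alphabet H \<O>) \<subseteq> carrier H"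
  by (rule products_closed[OF alphabet_closed])

lemma language_normal:
  assumes "x \<in> products H (assoc_alphabet H \<O>)"
  shows "x \<in> normal \<and> x\<^sup>\<star> \<in> normal \<and> (\<forall>h\<in>normal. x \<otimes> h \<in> normal \<and> x\<^sup>\<star> \<otimes> h \<in> normal)"
  using assms
proof (induction rule: products.induct)
  case (single x)
  then show ?case
    using letter_normal letter_mult_normal star_letter_mult_normal by (metis alphabet_letter)
next
  case (step x y)
  obtain b where b: "b \<in> B" "x = c b" using alphabet_letter[OF step(1)] .
  have y: "y \<in> carrier H" using step(2) alphabet_products_closed by blast
  show ?case
    using step(3) b y letter_normal[OF b(1)] letter_mult_normal[OF b(1)] star_letter_mult_normal[OF b(1)]
    by (simp add: star_mult mult_assoc normal_closed)
qed

lemma carrier_normal: assumes "h \<in> carrier H" shows "h \<in> normal"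
proof (cases "h = \<zero>")
  case False
  let ?L = "assoc_language H \<O>"
  have L: "x \<in> normal \<and> (\<forall>h\<in>normal. x \<otimes> h \<in> normal)" if "x \<in> ?L \<union> star H ` ?L" for x
    using that language_normal by (auto simp: assoc_language_def)
  have "h \<in> products H (?L \<union> star H ` ?L)" using gen assms False by (simp add: generates_def)
  then show ?thesis by (induction rule: products.induct) (use L in auto)
qed (simp add: zero_normal)

text \<open>If \<open>t\<close> began with a letter, the range idempotent of that letter would lie
  above the domain of \<open>x\<close>, which \<open>Q_not_below_O\<close> forbids.\<close>

lemma Q_domain_form:
  assumes x: "x \<in> carrier H" and Q: "x\<^sup>\<star> \<otimes> x \<in> Q"
  obtains u where "set u \<subseteq> B" "x = act u (x\<^sup>\<star> \<otimes> x)"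
proof -
  let ?\<alpha> = "x\<^sup>\<star> \<otimes> x"
  have "x \<noteq> \<zero>" using Q_nonzero[OF Q] by auto
  then obtain u t \<gamma> where h: "set u \<subseteq> B" "set t \<subseteq> B" "\<gamma> \<in> Q" "x = act u \<gamma> \<otimes> (act t \<gamma>)\<^sup>\<star>"
    using carrier_normal[OF x] unfolding normal_def by blast
  have \<gamma>: "\<gamma> \<in> carrier H" "\<gamma> \<otimes> \<gamma> = \<gamma>" "\<gamma>\<^sup>\<star> = \<gamma>"
    using h idems_mult_self[OF Q_idem] idems_star[OF Q_idem] by auto
  have "t = []"
  proof (rule ccontr)
    assume "t \<noteq> []"
    then obtain d t' where t: "t = d # t'" by (cases t) auto
    have d: "d \<in> B" "set t' \<subseteq> B" using h t by auto
    have tg: "(c d \<otimes> (c d)\<^sup>\<star>) \<otimes> act t \<gamma> = act t \<gamma>" using d \<gamma> t by (simp add: mult_assoc)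
    have xs: "x\<^sup>\<star> = act t \<gamma> \<otimes> (act u \<gamma>)\<^sup>\<star>" using h \<gamma> by (simp add: star_mult)
    have "(c d \<otimes> (c d)\<^sup>\<star>) \<otimes> x\<^sup>\<star> = x\<^sup>\<star>"
      unfolding xs by (subst mult_assoc[symmetric]) (use h d \<gamma> tg in auto)
    then have "(c d \<otimes> (c d)\<^sup>\<star>) \<otimes> ?\<alpha> = ?\<alpha>"
      by (subst mult_assoc[symmetric]) (use x d in auto)
    then show False using Q_not_below_O[OF Q letter_O[OF d(1)]] by blast
  qed
  then have xu: "x = act u \<gamma>" using h \<gamma> by (simp add: act_mult[symmetric])
  then have "x = x \<otimes> \<gamma>" using \<gamma> h by (simp add: act_mult[symmetric])
  then have "?\<alpha> = ?\<alpha> \<otimes> \<gamma>" using x \<gamma> by (simp add: mult_assoc)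
  also have "\<dots> = \<gamma> \<otimes> ?\<alpha>" using idems_commute Q_idem[OF Q] Q_idem[OF h(3)] by blast
  finally have "\<gamma> \<otimes> ?\<alpha> = ?\<alpha>" by simp
  moreover have "x = x \<otimes> ?\<alpha>" using x by simp
  ultimately have "x = act u ?\<alpha>" using act_mult[OF h(1) \<gamma>(1), of ?\<alpha>] x xu by simp
  then show ?thesis using that h by blast
qed

text \<open>Instead of proving that the two words of the normal form agree,
  \<open>e = e e\<^sup>\<star>\<close> is used: with \<open>e = x y\<^sup>\<star>\<close> it equals
  \<open>z z\<^sup>\<star>\<close> for \<open>z = x y\<^sup>\<star> y\<close>, and the domain of
  \<open>z\<close> is a nonzero product of two members of \<open>Q\<close>.\<close>

lemma idem_form:
  assumes e: "e \<in> idems H" "e \<noteq> \<zero>"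
  obtains x where "x \<in> carrier H" "x\<^sup>\<star> \<otimes> x \<in> Q" "e = x \<otimes> x\<^sup>\<star>"
proof -
  have ec: "e \<in> carrier H" using e by blast
  obtain u t \<gamma> where h: "set u \<subseteq> B" "set t \<subseteq> B" "\<gamma> \<in> Q" "e = act u \<gamma> \<otimes> (act t \<gamma>)\<^sup>\<star>"
    using carrier_normal[OF ec] e(2) unfolding normal_def by blast
  define x y where "x = act u \<gamma>" and "y = act t \<gamma>"
  have xy: "x \<in> carrier H" "y \<in> carrier H" "e = x \<otimes> y\<^sup>\<star>" using h by (auto simp: x_def y_def)
  have nz: "x \<noteq> \<zero>" "y \<noteq> \<zero>" using e(2) xy by auto
  have Q: "x\<^sup>\<star> \<otimes> x \<in> Q" "y\<^sup>\<star> \<otimes> y \<in> Q"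
    using act_star_mult_Q nz h unfolding x_def y_def by blast+
  define z where "z = x \<otimes> (y\<^sup>\<star> \<otimes> y)"
  have z: "z \<in> carrier H" using xy by (simp add: z_def)
  have "e = e \<otimes> e\<^sup>\<star>" using e(1) idems_star idems_mult_self by metis
  then have ez: "e = z \<otimes> z\<^sup>\<star>" using xy by (simp add: z_def star_mult mult_assoc)
  have c: "(x\<^sup>\<star> \<otimes> x) \<otimes> (y\<^sup>\<star> \<otimes> y) = (y\<^sup>\<star> \<otimes> y) \<otimes> (x\<^sup>\<star> \<otimes> x)"
    using idems_commute Q_idem[OF Q(1)] Q_idem[OF Q(2)] by blast
  have "z\<^sup>\<star> \<otimes> z = (y\<^sup>\<star> \<otimes> y) \<otimes> ((x\<^sup>\<star> \<otimes> x) \<otimes> (y\<^sup>\<star> \<otimes> y))"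
    using xy by (simp add: z_def star_mult mult_assoc)
  also have "\<dots> = (y\<^sup>\<star> \<otimes> y) \<otimes> (x\<^sup>\<star> \<otimes> x)" unfolding c using xy by (simp add: mult_assoc)
  finally have zz: "z\<^sup>\<star> \<otimes> z = (y\<^sup>\<star> \<otimes> y) \<otimes> (x\<^sup>\<star> \<otimes> x)" .
  have "z \<noteq> \<zero>" using ez e(2) by auto
  then have "z\<^sup>\<star> \<otimes> z \<noteq> \<zero>" using star_mult_eq_zero_iff z by blast
  then have "z\<^sup>\<star> \<otimes> z \<in> Q" using Q_mult[OF Q(2,1)] zz by simp
  then show ?thesis using that z ez by blast
qed

text \<open>In the form of \<open>idem_form\<close> an empty word would put \<open>e\<close> into
  \<open>Q\<close>; otherwise \<open>e\<close> lies below the range of the first letter, which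
  orthogonality makes equal to \<open>e\<close>.\<close>

lemma O_letter: assumes e: "e \<in> \<O>" obtains b where "b \<in> B" "e = c b \<otimes> (c b)\<^sup>\<star>"
proof -
  have nz: "e \<noteq> \<zero>" using e O_nonzero by auto
  obtain x where x: "x \<in> carrier H" "x\<^sup>\<star> \<otimes> x \<in> Q" "e = x \<otimes> x\<^sup>\<star>" using idem_form O_idem[OF e] nz by blast
  obtain u where u: "set u \<subseteq> B" "x = act u (x\<^sup>\<star> \<otimes> x)" using Q_domain_form[OF x(1,2)] .
  show ?thesis
  proof (cases u)
    case Nil
    then have "x \<in> Q" using u x(2) by simp
    then have "e = x" using x(3) idems_star[OF Q_idem] idems_mult_self[OF Q_idem] by simp
    then show ?thesis using \<open>x \<in> Q\<close> e by blast
  next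
    case (Cons b v)
    have b: "b \<in> B" "set v \<subseteq> B" using u Cons by auto
    define w where "w = act v (x\<^sup>\<star> \<otimes> x)"
    have w: "w \<in> carrier H" "x = c b \<otimes> w" using u(2) Cons b x by (auto simp: w_def)
    have "(c b \<otimes> (c b)\<^sup>\<star>) \<otimes> x = x" unfolding w(2) using b(1) w(1) by (simp add: mult_assoc)
    then have "(c b \<otimes> (c b)\<^sup>\<star>) \<otimes> e = e"
      unfolding x(3) by (subst mult_assoc[symmetric]) (use x b in auto)
    then show ?thesis using orth[OF letter_O[OF b(1)] e] nz that[OF b(1)] by simp
  qed
qed

section \<open>The transition matrix and its words\<close>

definition T :: "'b \<Rightarrow> 'b \<Rightarrow> nat" where "T a b = (if c a \<otimes> c b = \<zero> then 0 else 1)"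

lemma transition: "transition_matrix B T"
  unfolding transition_matrix_def
proof (intro conjI ballI)
  \<comment> \<open>\<open>idems H\<close> contains \<open>\<zero>\<close>, so (O2) provides a
    member of \<open>\<O>\<close>.\<close>
  obtain e where "e \<in> \<O>" using conds by (auto simp: O_conditions_def O2_def)
  then show "B \<noteq> {}" using O_letter by blast
next
  fix a assume a: "a \<in> B"
  \<comment> \<open>The domain of \<open>c a\<close> lies above some member of \<open>\<O>\<close>,
    and the letter whose range this is can follow \<open>a\<close>.\<close>
  obtain e where e: "e \<in> \<O>" "((c a)\<^sup>\<star> \<otimes> c a) \<otimes> e = e" using Q_above[OF letter_Q[OF a]] .
  obtain b where b: "b \<in> B" "e = c b \<otimes> (c b)\<^sup>\<star>" using O_letter[OF e(1)] .
  have "c a \<otimes> c b \<noteq> \<zero>"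
  proof
    assume z: "c a \<otimes> c b = \<zero>"
    have "e = ((c a)\<^sup>\<star> \<otimes> (c a \<otimes> c b)) \<otimes> (c b)\<^sup>\<star>" using e(2) b a by (simp add: mult_assoc)
    then show False using z a b e(1) O_nonzero by simp
  qed
  then show "\<exists>b\<in>B. T a b \<noteq> 0" using b(1) by (auto simp: T_def)
qed (simp add: T_def)

abbreviation "W \<equiv> lang B T"

lemma act_head:
  assumes "set v \<subseteq> B" "b \<in> B"
  obtains s where "act v (c b) = c (hd (v @ [b])) \<otimes> s" "s \<in> carrier H" "hd (v @ [b]) \<in> B"
proof (cases v)
  case Nil
  \<comment> \<open>With no identity at hand, the empty tail is represented by the domain idempotent
    of \<open>c b\<close>.\<close>
  then show ?thesis using that[of "(c b)\<^sup>\<star> \<otimes> c b"] assms by simp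
next
  case (Cons d v')
  then show ?thesis using that[of "act v' (c b)"] assms by simp
qed

text \<open>If \<open>c a \<otimes> c d\<close> is nonzero, the domain idempotent of
  \<open>c a\<close> fixes \<open>c d\<close>, so prepending \<open>c a\<close> to anything that
  begins with \<open>c d\<close> can be undone. Nonvanishing is therefore a condition on adjacent
  letters.\<close>

lemma word_iff:
  "v @ [b] \<in> W \<longleftrightarrow> set v \<subseteq> B \<and> b \<in> B \<and> act v (c b) \<noteq> \<zero>"
proof (induction v)
  case Nil
  then show ?case using lang_single[OF transition] letter_nonzero by auto
next
  case (Cons a v)
  let ?d = "hd (v @ [b])"
  have W: "a # v @ [b] \<in> W \<longleftrightarrow> a \<in> B \<and> v @ [b] \<in> W \<and> T a ?d = 1"
    using lang_append[OF transition, of "[a]" "v @ [b]"] lang_single[OF transition] by simp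
  have "c a \<otimes> act v (c b) \<noteq> \<zero> \<longleftrightarrow> T a ?d = 1 \<and> act v (c b) \<noteq> \<zero>"
    if B: "a \<in> B" "set v \<subseteq> B" "b \<in> B"
  proof -
    obtain s where s: "act v (c b) = c ?d \<otimes> s" "s \<in> carrier H" "?d \<in> B"
      using act_head B by blast
    show ?thesis
    proof
      assume nz: "c a \<otimes> act v (c b) \<noteq> \<zero>"
      have "c a \<otimes> act v (c b) = (c a \<otimes> c ?d) \<otimes> s" unfolding s(1) using s B by (simp add: mult_assoc)
      then have "c a \<otimes> c ?d \<noteq> \<zero>" using nz s by auto
      then show "T a ?d = 1 \<and> act v (c b) \<noteq> \<zero>" using nz B by (auto simp: T_def)
    next
      assume *: "T a ?d = 1 \<and> act v (c b) \<noteq> \<zero>"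
      then have "c a \<otimes> c ?d \<noteq> \<zero>" by (auto simp: T_def)
      then have eq: "(c a)\<^sup>\<star> \<otimes> (c a \<otimes> c ?d) = c ?d"
        using star_letter_act[of a "[?d]" "(c ?d)\<^sup>\<star> \<otimes> c ?d"] B s by simp
      have "(c a)\<^sup>\<star> \<otimes> (c a \<otimes> act v (c b)) = ((c a)\<^sup>\<star> \<otimes> (c a \<otimes> c ?d)) \<otimes> s"
        unfolding s(1) using s B by (simp add: mult_assoc)
      then have "(c a)\<^sup>\<star> \<otimes> (c a \<otimes> act v (c b)) = act v (c b)" using eq s(1) by simp
      then show "c a \<otimes> act v (c b) \<noteq> \<zero>" using * B by auto
    qed
  qed
  then show ?case using Cons W by auto
qed

lemma wordD: "v @ [b] \<in> W \<Longrightarrow> set v \<subseteq> B" "v @ [b] \<in> W \<Longrightarrow> b \<in> B" "v @ [b] \<in> W \<Longrightarrow> act v (c b) \<noteq> \<zero>"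
  using word_iff by auto

lemma word_ConsD: "(a # v) @ [b] \<in> W \<Longrightarrow> a \<in> B \<and> v @ [b] \<in> W"
  using word_iff[of "a # v" b] word_iff[of v b] by auto

lemma word_cancel:
  assumes "(a # v) @ [b] \<in> W" shows "(c a)\<^sup>\<star> \<otimes> (c a \<otimes> act v (c b)) = act v (c b)"
proof -
  have B: "a \<in> B" "set v \<subseteq> B" "b \<in> B" "c a \<otimes> act v (c b) \<noteq> \<zero>" using assms word_iff[of "a # v" b] by auto
  have "act v (c b) = act (v @ [b]) ((c b)\<^sup>\<star> \<otimes> c b)" using B by (simp add: act_append)
  then show ?thesis using star_letter_act[of a "v @ [b]" "(c b)\<^sup>\<star> \<otimes> c b"] B by simp
qed

text \<open>Orthogonality would give \<open>b = a\<close>; cancelling it shows that the domain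
  idempotent of \<open>c b\<close> equals \<open>act v (c b)\<close>, an element that begins with a
  letter and so cannot lie in \<open>Q\<close>.\<close>

lemma letter_not_longer:
  assumes W: "(a # v) @ [b] \<in> W" shows "c b \<noteq> act (a # v) (c b)"
proof
  assume eq: "c b = act (a # v) (c b)"
  have B: "a \<in> B" "set v \<subseteq> B" "b \<in> B" "c a \<otimes> act v (c b) \<noteq> \<zero>" using W word_iff[of "a # v" b] by auto
  define p where "p = act v (c b)"
  have p: "p \<in> carrier H" "c b = c a \<otimes> p" using eq B by (auto simp: p_def)
  have "(c b)\<^sup>\<star> \<otimes> (c a \<otimes> p) \<noteq> \<zero>"
    using p(2) letter_Q[OF B(3)] Q_nonzero by metis
  then have "(c b)\<^sup>\<star> \<otimes> c a \<noteq> \<zero>" using B p by (auto simp: mult_assoc[symmetric])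
  then have ab: "b = a" using letter_orth B by blast
  have "(c b)\<^sup>\<star> \<otimes> c b = (c a)\<^sup>\<star> \<otimes> (c a \<otimes> p)" using p(2) ab by simp
  also have "\<dots> = p" using word_cancel[OF W] by (simp add: p_def)
  finally have pQ: "p \<in> Q" using letter_Q[OF B(3)] by simp
  obtain d s where d: "d \<in> B" "p = c d \<otimes> s" "s \<in> carrier H"
    using act_head[OF B(2,3)] p_def by metis
  have "(c d \<otimes> (c d)\<^sup>\<star>) \<otimes> p = p" unfolding d(2) using d by (simp add: mult_assoc)
  then show False using Q_not_below_O[OF pQ letter_O[OF d(1)]] by blast
qed

text \<open>\<open>letter_orth\<close> forces the first letters to agree and they cancel;
  \<open>letter_not_longer\<close> excludes that one word is exhausted before the other.\<close>

lemma word_inj: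
  "\<lbrakk>v @ [b] \<in> W; w @ [b] \<in> W; act v (c b) = act w (c b)\<rbrakk> \<Longrightarrow> v = w"
proof (induction v arbitrary: w)
  case Nil
  then show ?case using letter_not_longer by (cases w) auto
next
  case (Cons a v)
  show ?case
  proof (cases w)
    case Nil
    then show ?thesis using Cons.prems letter_not_longer[OF Cons.prems(1)] by auto
  next
    case (Cons a' w')
    note W = Cons.prems(1) Cons.prems(2)[unfolded Cons] and eq = Cons.prems(3)[unfolded Cons]
    have B: "a \<in> B" "a' \<in> B" "set v \<subseteq> B" "set w' \<subseteq> B" "b \<in> B"
      and nz: "act v (c b) \<noteq> \<zero>" using word_ConsD[OF W(1)] word_ConsD[OF W(2)] wordD by auto
    have *: "(c a)\<^sup>\<star> \<otimes> (c a' \<otimes> act w' (c b)) = act v (c b)" using word_cancel[OF W(1)] eq by simp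
    then have "(c a)\<^sup>\<star> \<otimes> c a' \<noteq> \<zero>" using nz B by (auto simp: mult_assoc[symmetric])
    then have aa: "a = a'" using letter_orth B by blast
    have "act v (c b) = act w' (c b)" 
      by (rule trans[OF sym[OF *[unfolded aa]] word_cancel[OF W(2)]])
    then show ?thesis using Cons.IH word_ConsD[OF W(1)] word_ConsD[OF W(2)] aa Cons by blast
  qed
qed

section \<open>Germs of words and the action of \<open>H\<close>\<close>

text \<open>\<open>U b\<close> is the trace on \<open>Q\<close> of the filter of idempotents whose domain contains
  the one-letter word \<open>[b]\<close>.\<close>

definition U :: "'b \<Rightarrow> 'a set" where "U b = {\<alpha> \<in> Q. \<alpha> \<otimes> c b = c b}"

lemma U_Q: "\<alpha> \<in> U b \<Longrightarrow> \<alpha> \<in> Q" and U_letter: "\<alpha> \<in> U b \<Longrightarrow> \<alpha> \<otimes> c b = c b"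
  by (auto simp: U_def)

lemma U_closed [simp, intro]: "\<alpha> \<in> U b \<Longrightarrow> \<alpha> \<in> carrier H"
  using U_Q by blast

lemma U_mult: assumes "\<alpha> \<in> U b" "\<beta> \<in> U b" "b \<in> B" shows "\<alpha> \<otimes> \<beta> \<in> U b"
proof -
  have eq: "\<alpha> \<otimes> \<beta> \<otimes> c b = c b" using assms U_letter by (simp add: mult_assoc)
  then have "\<alpha> \<otimes> \<beta> \<noteq> \<zero>" using assms(3) letter_nonzero[OF assms(3)] zero_left by fastforce
  then show ?thesis using eq Q_mult U_Q assms by (auto simp: U_def)
qed

lemma letter_U: assumes "a \<in> B" "b \<in> B" "T a b = 1" shows "(c a)\<^sup>\<star> \<otimes> c a \<in> U b"
proof -
  have "c a \<otimes> c b \<noteq> \<zero>" using assms by (auto simp: T_def)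
  then have "(c a)\<^sup>\<star> \<otimes> (c a \<otimes> c b) = c b"
    using star_letter_act[of a "[b]" "(c b)\<^sup>\<star> \<otimes> c b"] assms by simp
  then show ?thesis using assms letter_Q[OF assms(1)] by (simp add: U_def mult_assoc)
qed

lemma word_snoc_U: assumes "(v @ [a]) @ [b] \<in> W" shows "(c a)\<^sup>\<star> \<otimes> c a \<in> U b"
proof -
  have "T a b = 1" using assms lang_append[OF transition, of "v @ [a]" "[b]"] by simp
  then show ?thesis using assms letter_U wordD[OF assms] by simp
qed

lemma act_U_letter:
  "\<lbrakk>\<alpha> \<in> U b; b \<in> B; set v \<subseteq> B\<rbrakk> \<Longrightarrow> act v \<alpha> \<otimes> c b = act v (c b)"
  using act_mult[of v \<alpha> "c b"] U_letter[of \<alpha> b] by simp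

text \<open>By \<open>act_star_mult\<close> the domain of \<open>act v \<gamma>\<close> is
  \<open>\<gamma>\<close> cut down by the domain idempotent of the last letter of \<open>v\<close>,
  so \<open>\<beta>\<close> includes that factor. The clause for all smaller \<open>\<gamma>\<close>
  allows a second restriction without losing the first.\<close>

lemma small_domain:
  assumes W: "v @ [b] \<in> W" and \<alpha>: "\<alpha> \<in> U b"
  obtains \<beta> where "\<beta> \<in> U b" "\<alpha> \<otimes> \<beta> = \<beta>"
    "\<And>\<gamma>. \<lbrakk>\<gamma> \<in> U b; \<beta> \<otimes> \<gamma> = \<gamma>\<rbrakk> \<Longrightarrow> (act v \<gamma>)\<^sup>\<star> \<otimes> act v \<gamma> = \<gamma>"
proof (cases v rule: rev_cases)
  case Nil
  show ?thesis
    by (rule that[of \<alpha>])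
      (use \<alpha> Nil U_Q Q_idem in \<open>auto simp: idems_star idems_mult_self\<close>)
next
  case (snoc u a)
  have B: "a \<in> B" "set u \<subseteq> B" "b \<in> B" using W snoc wordD[OF W] by auto
  let ?\<delta> = "(c a)\<^sup>\<star> \<otimes> c a"
  have \<delta>: "?\<delta> \<in> U b" using word_snoc_U W snoc by simp
  have i: "\<alpha> \<in> idems H" "?\<delta> \<in> idems H" using \<alpha> \<delta> U_Q Q_idem by blast+
  show ?thesis
  proof (rule that[of "\<alpha> \<otimes> ?\<delta>"])
    show "\<alpha> \<otimes> ?\<delta> \<in> U b" using U_mult \<alpha> \<delta> B by blast
    show "\<alpha> \<otimes> (\<alpha> \<otimes> ?\<delta>) = \<alpha> \<otimes> ?\<delta>" using idems_mult_self_assoc i B by simp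
  next
    fix \<gamma> assume \<gamma>: "\<gamma> \<in> U b" "\<alpha> \<otimes> ?\<delta> \<otimes> \<gamma> = \<gamma>"
    have gi: "\<gamma> \<in> idems H" using \<gamma> U_Q Q_idem by blast
    have gc: "\<gamma> \<in> carrier H" "\<alpha> \<in> carrier H" using \<gamma>(1) \<alpha> by auto
    have "?\<delta> \<otimes> \<gamma> = ?\<delta> \<otimes> ((?\<delta> \<otimes> \<alpha>) \<otimes> \<gamma>)" using \<gamma>(2) idems_commute[OF i] by simp
    also have "\<dots> = (?\<delta> \<otimes> \<alpha>) \<otimes> \<gamma>" using B gc by (simp add: mult_assoc)
    also have "\<dots> = \<gamma>" using \<gamma>(2) idems_commute[OF i] by simp
    finally have dg: "?\<delta> \<otimes> \<gamma> = \<gamma>" .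
    have "act v \<gamma> \<otimes> c b = act v (c b)" using act_U_letter \<gamma>(1) wordD[OF W] by blast
    then have "act v \<gamma> \<noteq> \<zero>" using wordD[OF W] by auto
    then have "(act v \<gamma>)\<^sup>\<star> \<otimes> act v \<gamma> = \<gamma>\<^sup>\<star> \<otimes> (?\<delta> \<otimes> \<gamma>)"
      using act_star_mult[of u a \<gamma>] B gc snoc by simp
    then show "(act v \<gamma>)\<^sup>\<star> \<otimes> act v \<gamma> = \<gamma>" using dg gi idems_star idems_mult_self by simp
  qed
qed

text \<open>\<open>H\<close> acts on words by germs: \<open>h\<close> maps \<open>vb\<close> to \<open>v'b\<close> when left multiplication by \<open>h\<close> maps
  \<open>v\<close>, restricted to a neighbourhood of \<open>[b]\<close>, to \<open>v'\<close> restricted to the same neighbourhood.\<close>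

definition rel :: "'a \<Rightarrow> 'b list \<Rightarrow> 'b list \<Rightarrow> bool" where
  "rel h w w' \<longleftrightarrow> (\<exists>v v' b. w = v @ [b] \<and> w' = v' @ [b] \<and> w \<in> W \<and> w' \<in> W \<and>
     (\<exists>\<alpha>\<in>U b. h \<otimes> act v \<alpha> = act v' \<alpha>))"

lemma relI: "\<lbrakk>v @ [b] \<in> W; v' @ [b] \<in> W; \<alpha> \<in> U b; h \<otimes> act v \<alpha> = act v' \<alpha>\<rbrakk> \<Longrightarrow> rel h (v @ [b]) (v' @ [b])"
  unfolding rel_def by blast

lemma relD:
  assumes "rel h w w'"
  obtains v v' b \<alpha> where "w = v @ [b]" "w' = v' @ [b]" "v @ [b] \<in> W" "v' @ [b] \<in> W"
    "\<alpha> \<in> U b" "h \<otimes> act v \<alpha> = act v' \<alpha>"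
  using assms unfolding rel_def by blast

text \<open>Multiplying the germ equation by \<open>c b\<close> replaces the unknown neighbourhood
  \<open>\<alpha>\<close> by the letter itself, where \<open>word_iff\<close> and
  \<open>word_inj\<close> apply.\<close>

lemma rel_letter:
  assumes "h \<otimes> act v \<alpha> = act v' \<alpha>" "\<alpha> \<in> U b" "h \<in> carrier H" "b \<in> B" "set v \<subseteq> B" "set v' \<subseteq> B"
  shows "h \<otimes> act v (c b) = act v' (c b)"
  using assms act_U_letter[of \<alpha> b v] act_U_letter[of \<alpha> b v'] by (metis U_closed act_closed letter_closed mult_assoc)

lemma rel_unique:
  assumes "rel h w w'" "rel h w w''" "h \<in> carrier H" shows "w' = w''"
proof -
  obtain v v' b \<alpha> where 1: "w = v @ [b]" "w' = v' @ [b]" "v @ [b] \<in> W" "v' @ [b] \<in> W"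
    "\<alpha> \<in> U b" "h \<otimes> act v \<alpha> = act v' \<alpha>" using relD[OF assms(1)] .
  obtain u v'' b' \<beta> where 2: "w = u @ [b']" "w'' = v'' @ [b']" "v'' @ [b'] \<in> W"
    "\<beta> \<in> U b'" "h \<otimes> act u \<beta> = act v'' \<beta>" using relD[OF assms(2)] .
  have u: "u = v" "b' = b" using 1 2 by auto
  have "act v' (c b) = act v'' (c b)"
    using rel_letter[of h v \<alpha> v' b] rel_letter[of h v \<beta> v'' b] 1 2 u wordD assms(3) by metis
  then show ?thesis using word_inj 1 2 u by blast
qed

text \<open>Two nested uses of \<open>small_domain\<close>, the first for \<open>v\<close> and the
  second for \<open>v'\<close>, inside the neighbourhood \<open>\<alpha>\<close>. Equal domains on
  both sides are what makes a germ invertible.\<close>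

lemma rel_good:
  assumes W: "v @ [b] \<in> W" "v' @ [b] \<in> W" and \<alpha>: "\<alpha> \<in> U b" "h \<otimes> act v \<alpha> = act v' \<alpha>" and h: "h \<in> carrier H"
  obtains \<beta> where "\<beta> \<in> U b" "h \<otimes> act v \<beta> = act v' \<beta>"
    "(act v \<beta>)\<^sup>\<star> \<otimes> act v \<beta> = \<beta>" "(act v' \<beta>)\<^sup>\<star> \<otimes> act v' \<beta> = \<beta>"
proof -
  have B: "set v \<subseteq> B" "set v' \<subseteq> B" using W wordD by auto
  obtain \<beta> where \<beta>: "\<beta> \<in> U b" "\<alpha> \<otimes> \<beta> = \<beta>"
    "\<And>\<gamma>. \<lbrakk>\<gamma> \<in> U b; \<beta> \<otimes> \<gamma> = \<gamma>\<rbrakk> \<Longrightarrow> (act v \<gamma>)\<^sup>\<star> \<otimes> act v \<gamma> = \<gamma>"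
    using small_domain[OF W(1) \<alpha>(1)] by blast
  obtain \<gamma> where \<gamma>: "\<gamma> \<in> U b" "\<beta> \<otimes> \<gamma> = \<gamma>"
    "\<And>\<delta>. \<lbrakk>\<delta> \<in> U b; \<gamma> \<otimes> \<delta> = \<delta>\<rbrakk> \<Longrightarrow> (act v' \<delta>)\<^sup>\<star> \<otimes> act v' \<delta> = \<delta>"
    using small_domain[OF W(2) \<beta>(1)] by blast
  have "\<alpha> \<otimes> \<gamma> = \<alpha> \<otimes> (\<beta> \<otimes> \<gamma>)" using \<gamma>(2) by simp
  also have "\<dots> = (\<alpha> \<otimes> \<beta>) \<otimes> \<gamma>" by (subst mult_assoc) (use \<alpha> \<beta>(1) \<gamma>(1) in auto)
  finally have ag: "\<alpha> \<otimes> \<gamma> = \<gamma>" using \<beta>(2) \<gamma>(2) by simp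
  have "h \<otimes> act v (\<alpha> \<otimes> \<gamma>) = (h \<otimes> act v \<alpha>) \<otimes> \<gamma>"
    using B \<alpha>(1) \<gamma>(1) h by (subst act_mult) (auto simp: mult_assoc)
  also have "\<dots> = act v' (\<alpha> \<otimes> \<gamma>)" using B \<alpha> \<gamma>(1) by (subst act_mult) auto
  finally have "h \<otimes> act v \<gamma> = act v' \<gamma>" using ag by simp
  moreover have "\<gamma> \<otimes> \<gamma> = \<gamma>" using \<gamma>(1) U_Q Q_idem idems_mult_self by blast
  ultimately show ?thesis using that \<beta>(3)[OF \<gamma>(1,2)] \<gamma> by blast
qed

text \<open>On a good neighbourhood \<open>x\<close> and \<open>h \<otimes> x\<close> have the same
  domain, so \<open>idem_absorb\<close> shows that \<open>h\<^sup>\<star> \<otimes> h\<close> fixes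
  \<open>x\<close>, and the germ equation can be solved for \<open>x\<close>.\<close>

lemma rel_star: assumes "rel h w w'" "h \<in> carrier H" shows "rel (h\<^sup>\<star>) w' w"
proof -
  obtain v v' b \<alpha> where 1: "w = v @ [b]" "w' = v' @ [b]" "v @ [b] \<in> W" "v' @ [b] \<in> W"
    "\<alpha> \<in> U b" "h \<otimes> act v \<alpha> = act v' \<alpha>" using relD[OF assms(1)] .
  obtain \<beta> where \<beta>: "\<beta> \<in> U b" "h \<otimes> act v \<beta> = act v' \<beta>"
    "(act v \<beta>)\<^sup>\<star> \<otimes> act v \<beta> = \<beta>" "(act v' \<beta>)\<^sup>\<star> \<otimes> act v' \<beta> = \<beta>"
    using rel_good[OF 1(3-6) assms(2)] .
  define x where "x = act v \<beta>"
  have x: "x \<in> carrier H" using 1 \<beta> wordD by (auto simp: x_def)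
  have "x\<^sup>\<star> \<otimes> ((h\<^sup>\<star> \<otimes> h) \<otimes> x) = (h \<otimes> x)\<^sup>\<star> \<otimes> (h \<otimes> x)"
    using x assms(2) by (simp add: star_mult mult_assoc)
  also have "\<dots> = x\<^sup>\<star> \<otimes> x" using \<beta> by (simp add: x_def)
  finally have "(h\<^sup>\<star> \<otimes> h) \<otimes> x = x" using idem_absorb[OF star_mult_idem[OF assms(2)] x] by simp
  then have "h\<^sup>\<star> \<otimes> act v' \<beta> = act v \<beta>" using x assms(2) \<beta>(2) by (simp add: x_def[symmetric] mult_assoc)
  then show ?thesis using relI 1 \<beta>(1) by blast
qed

text \<open>From left to right an intermediate word has to be found: \<open>h\<close> applied to a
  good germ has its domain in \<open>Q\<close>, so \<open>Q_domain_form\<close> spells it as a word.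
  From right to left the product of the two neighbourhoods serves both equations.\<close>

lemma rel_mult:
  assumes g: "g \<in> carrier H" and h: "h \<in> carrier H"
  shows "rel (g \<otimes> h) w w'' \<longleftrightarrow> (\<exists>w'. rel h w w' \<and> rel g w' w'')"
proof
  assume "rel (g \<otimes> h) w w''"
  then obtain v v'' b \<alpha>0 where 0: "w = v @ [b]" "w'' = v'' @ [b]" "v @ [b] \<in> W" "v'' @ [b] \<in> W"
    "\<alpha>0 \<in> U b" "(g \<otimes> h) \<otimes> act v \<alpha>0 = act v'' \<alpha>0" by (rule relD)
  obtain \<alpha> where \<alpha>: "\<alpha> \<in> U b" "(g \<otimes> h) \<otimes> act v \<alpha> = act v'' \<alpha>"
    "(act v \<alpha>)\<^sup>\<star> \<otimes> act v \<alpha> = \<alpha>" "(act v'' \<alpha>)\<^sup>\<star> \<otimes> act v'' \<alpha> = \<alpha>"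
    using rel_good[OF 0(3-6)] g h by auto
  have B: "b \<in> B" "set v \<subseteq> B" "set v'' \<subseteq> B" using 0 wordD by auto
  define y x where "y = act v \<alpha>" and "x = h \<otimes> y"
  have y: "y \<in> carrier H" "y\<^sup>\<star> \<otimes> y = \<alpha>" using \<alpha> B by (auto simp: y_def)
  have x: "x \<in> carrier H" using y h by (simp add: x_def)
  have gx: "g \<otimes> x = act v'' \<alpha>" using \<alpha>(2) g h y by (simp add: x_def y_def mult_assoc)
  \<comment> \<open>\<open>g \<otimes> h\<close> does not shrink the domain of \<open>y\<close>, so
    its domain idempotent fixes \<open>y\<close>; that of \<open>h\<close> is larger and fixes
    \<open>y\<close> too.\<close>
  have yy: "((g \<otimes> h)\<^sup>\<star> \<otimes> (g \<otimes> h)) \<otimes> y = y"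
  proof (rule idem_absorb)
    have "y\<^sup>\<star> \<otimes> (((g \<otimes> h)\<^sup>\<star> \<otimes> (g \<otimes> h)) \<otimes> y) = ((g \<otimes> h) \<otimes> y)\<^sup>\<star> \<otimes> ((g \<otimes> h) \<otimes> y)"
      using y g h by (simp add: star_mult mult_assoc)
    then show "y\<^sup>\<star> \<otimes> (((g \<otimes> h)\<^sup>\<star> \<otimes> (g \<otimes> h)) \<otimes> y) = y\<^sup>\<star> \<otimes> y"
      using \<alpha> by (simp add: y_def)
  qed (use y g h in \<open>auto intro: star_mult_idem\<close>)
  have "(h\<^sup>\<star> \<otimes> h) \<otimes> y = (h\<^sup>\<star> \<otimes> h) \<otimes> ((h\<^sup>\<star> \<otimes> ((g\<^sup>\<star> \<otimes> g) \<otimes> h)) \<otimes> y)"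
    using yy g h y by (simp add: star_mult mult_assoc)
  also have "\<dots> = ((g \<otimes> h)\<^sup>\<star> \<otimes> (g \<otimes> h)) \<otimes> y" using g h y by (simp add: star_mult mult_assoc)
  finally have hy: "(h\<^sup>\<star> \<otimes> h) \<otimes> y = y" using yy by simp
  have xx: "x\<^sup>\<star> \<otimes> x = \<alpha>"
    using hy y h by (simp add: x_def star_mult mult_assoc)
  obtain u where u: "set u \<subseteq> B" "x = act u \<alpha>"
    using Q_domain_form[OF x] U_Q[OF \<alpha>(1)] unfolding xx by blast
  \<comment> \<open>Evaluating at the letter shows that the intermediate word is nonzero, hence in
    \<open>W\<close>.\<close>
  have "g \<otimes> act u (c b) = act v'' (c b)"
    using rel_letter[OF _ \<alpha>(1) g B(1) u(1) B(3)] gx u by simp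
  then have "act u (c b) \<noteq> \<zero>" using wordD(3)[OF 0(4)] g by auto
  then have W: "u @ [b] \<in> W" using word_iff u B by blast
  have "rel h w (u @ [b])" using relI[OF 0(3) W \<alpha>(1)] 0(1) u(2) by (simp add: x_def y_def)
  moreover have "rel g (u @ [b]) w''" using relI[OF W 0(4) \<alpha>(1)] 0(2) u(2) gx by simp
  ultimately show "\<exists>w'. rel h w w' \<and> rel g w' w''" by blast
next
  assume "\<exists>w'. rel h w w' \<and> rel g w' w''"
  then obtain w' where r: "rel h w w'" "rel g w' w''" by blast
  obtain v v' b \<alpha> where 1: "w = v @ [b]" "w' = v' @ [b]" "v @ [b] \<in> W" "v' @ [b] \<in> W"
    "\<alpha> \<in> U b" "h \<otimes> act v \<alpha> = act v' \<alpha>" using relD[OF r(1)] .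
  obtain u v'' b' \<beta> where 2: "w' = u @ [b']" "w'' = v'' @ [b']" "v'' @ [b'] \<in> W"
    "\<beta> \<in> U b'" "g \<otimes> act u \<beta> = act v'' \<beta>" using relD[OF r(2)] .
  have u: "u = v'" "b' = b" using 1 2 by auto
  have B: "b \<in> B" "set v \<subseteq> B" "set v' \<subseteq> B" "set v'' \<subseteq> B" using 1 2 u wordD by auto
  have C: "\<alpha> \<in> carrier H" "\<beta> \<in> carrier H" using 1(5) 2(4) by auto
  have c: "\<alpha> \<otimes> \<beta> = \<beta> \<otimes> \<alpha>" using 1(5) 2(4) U_Q Q_idem idems_commute by blast
  have "(g \<otimes> h) \<otimes> act v (\<alpha> \<otimes> \<beta>) = g \<otimes> ((h \<otimes> act v \<alpha>) \<otimes> \<beta>)"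
    using B C g h by (simp add: act_mult mult_assoc)
  also have "\<dots> = g \<otimes> act v' (\<alpha> \<otimes> \<beta>)" using 1(6) B C by (simp add: act_mult)
  also have "\<dots> = (g \<otimes> act v' \<beta>) \<otimes> \<alpha>" using c B C g by (simp add: act_mult mult_assoc)
  also have "\<dots> = act v'' (\<alpha> \<otimes> \<beta>)" using 2(5) u c B C by (simp add: act_mult)
  finally show "rel (g \<otimes> h) w w''" using relI 1 2 u U_mult[of \<alpha> b \<beta>] B(1) by metis
qed

text \<open>The counterpart in \<open>H\<close> of a shape with empty input word: the admissible
  first letters are those fixed by \<open>\<gamma>\<close>.\<close>

lemma rel_act:
  assumes u: "set u \<subseteq> B" and \<gamma>: "\<gamma> \<in> Q"
  shows "rel (act u \<gamma>) w w' \<longleftrightarrow>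
    w \<in> W \<and> u @ w \<in> W \<and> w' = u @ w \<and> \<gamma> \<otimes> c (hd w) = c (hd w)"
proof
  assume r: "rel (act u \<gamma>) w w'"
  obtain v v' b \<alpha> where 1: "w = v @ [b]" "w' = v' @ [b]" "v @ [b] \<in> W" "v' @ [b] \<in> W"
    "\<alpha> \<in> U b" "act u \<gamma> \<otimes> act v \<alpha> = act v' \<alpha>" using relD[OF r] .
  have B: "b \<in> B" "set v \<subseteq> B" "set v' \<subseteq> B" using 1 wordD by auto
  obtain s where s: "act v (c b) = c (hd w) \<otimes> s" "s \<in> carrier H" "hd w \<in> B"
    using act_head[OF B(2,1)] 1(1) by blast
  have g: "\<gamma> \<in> carrier H" using \<gamma> by auto
  have "act u \<gamma> \<otimes> act v (c b) = act v' (c b)"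
    using rel_letter[OF 1(6,5) _ B(1,2,3)] u g by blast
  then have eq: "act u (\<gamma> \<otimes> act v (c b)) = act v' (c b)" using u g B by (simp add: act_mult)
  then have nz: "\<gamma> \<otimes> act v (c b) \<noteq> \<zero>" using wordD(3)[OF 1(4)] u by auto
  have *: "\<gamma> \<otimes> act v (c b) = (\<gamma> \<otimes> c (hd w)) \<otimes> s" unfolding s(1) using g s by (simp add: mult_assoc)
  then have "\<gamma> \<otimes> c (hd w) \<noteq> \<zero>" using nz s by auto
  then have gc: "\<gamma> \<otimes> c (hd w) = c (hd w)" using Q_letter \<gamma> s(3) by blast
  then have eq': "act (u @ v) (c b) = act v' (c b)" using * eq s(1) by (simp add: act_append)
  then have W: "(u @ v) @ [b] \<in> W" using wordD(3)[OF 1(4)] u B by (simp add: word_iff del: append_assoc)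
  then have "u @ v = v'" using word_inj 1(4) eq' by blast
  then show "w \<in> W \<and> u @ w \<in> W \<and> w' = u @ w \<and> \<gamma> \<otimes> c (hd w) = c (hd w)"
    using 1 W gc by auto
next
  assume a: "w \<in> W \<and> u @ w \<in> W \<and> w' = u @ w \<and> \<gamma> \<otimes> c (hd w) = c (hd w)"
  then have "w \<noteq> []" using lang_iff[OF transition] by blast
  then obtain v b where w: "w = v @ [b]" by (metis rev_exhaust)
  have W: "v @ [b] \<in> W" "(u @ v) @ [b] \<in> W" using a w by auto
  have B: "b \<in> B" "set v \<subseteq> B" using wordD[OF W(1)] by auto
  have g: "\<gamma> \<in> carrier H" using \<gamma> by auto
  \<comment> \<open>For empty \<open>v\<close> the neighbourhood is \<open>\<gamma>\<close> itself.
    Otherwise \<open>\<gamma>\<close> fixes the first letter of \<open>v\<close>, so any member of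
    \<open>U b\<close> works, and the domain idempotent of the last letter of \<open>v\<close> is
    one.\<close>
  have "\<exists>\<alpha>\<in>U b. \<gamma> \<otimes> act v \<alpha> = act v \<alpha>"
  proof (cases v rule: rev_cases)
    case Nil
    then show ?thesis using a w \<gamma> idems_mult_self[OF Q_idem] by (intro bexI[of _ \<gamma>]) (auto simp: U_def)
  next
    case (snoc v0 d)
    have \<delta>: "(c d)\<^sup>\<star> \<otimes> c d \<in> U b" using word_snoc_U W(1) snoc by simp
    have "v \<noteq> []" using snoc by simp
    then obtain e v1 where v: "v = e # v1" by (cases v) auto
    have "\<gamma> \<otimes> act v x = act v x" if "x \<in> carrier H" for x
    proof -
      have "\<gamma> \<otimes> act v x = (\<gamma> \<otimes> c e) \<otimes> act v1 x" using v B g that by (simp add: mult_assoc)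
      also have "\<dots> = act v x" using a w v by simp
      finally show ?thesis .
    qed
    then show ?thesis using \<delta> by blast
  qed
  then obtain \<alpha> where \<alpha>: "\<alpha> \<in> U b" "\<gamma> \<otimes> act v \<alpha> = act v \<alpha>" by blast
  have "act u \<gamma> \<otimes> act v \<alpha> = act (u @ v) \<alpha>"
    using u g B \<alpha> act_mult[of u \<gamma> "act v \<alpha>"] by (simp add: act_append)
  then show "rel (act u \<gamma>) w w'" using relI[OF W \<alpha>(1)] a w by simp
qed

section \<open>The homomorphism onto the hull\<close>

definition phi :: "'a \<Rightarrow> ('b list \<rightharpoonup> 'b list)" where
  "phi h = (\<lambda>w. if \<exists>w'. rel h w w' then Some (THE w'. rel h w w') else None)"

lemma phi_Some_iff: assumes "h \<in> carrier H" shows "phi h w = Some w' \<longleftrightarrow> rel h w w'"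
proof -
  have "rel h w w' \<Longrightarrow> (THE w'. rel h w w') = w'" for w'
    using rel_unique assms by blast
  then show ?thesis by (auto simp: phi_def)
qed

lemma phi_partial_bijection: assumes "h \<in> carrier H" shows "phi h \<in> carrier (partial_bijections W)"
  unfolding partial_bijections_carrier phi_Some_iff[OF assms]
proof (intro conjI allI impI)
  fix x x' y assume "rel h x y" "rel h x' y"
  then show "x = x'" using rel_star rel_unique assms by blast
qed (auto elim: relD)

lemma phi_mult: "\<lbrakk>g \<in> carrier H; h \<in> carrier H\<rbrakk> \<Longrightarrow> phi (g \<otimes> h) = phi g \<circ>\<^sub>m phi h"
  by (rule map_eqI) (simp add: phi_Some_iff rel_mult map_comp_Some_iff)

lemma phi_star: assumes "h \<in> carrier H" shows "phi (h\<^sup>\<star>) = star (partial_bijections W) (phi h)"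
proof (rule map_eqI)
  fix x y
  have "rel (h\<^sup>\<star>) x y \<longleftrightarrow> rel h y x" using rel_star[of h y x] rel_star[of "h\<^sup>\<star>" x y] assms by auto
  then show "phi (h\<^sup>\<star>) x = Some y \<longleftrightarrow> star (partial_bijections W) (phi h) x = Some y"
    using assms by (simp add: phi_Some_iff star_partial_bijections[OF phi_partial_bijection])
qed

lemma phi_zero: "phi \<zero> = Map.empty"
proof -
  have "\<not> rel \<zero> w w'" for w w'
  proof
    assume "rel \<zero> w w'"
    then obtain v v' b \<alpha> where 1: "v @ [b] \<in> W" "v' @ [b] \<in> W"
      "\<alpha> \<in> U b" "\<zero> \<otimes> act v \<alpha> = act v' \<alpha>" by (rule relD)
    then have "\<zero> \<otimes> act v (c b) = act v' (c b)" using rel_letter wordD by blast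
    then show False using wordD(1,2)[OF 1(1)] wordD(3)[OF 1(2)] by simp
  qed
  then show ?thesis by (auto simp: phi_def)
qed

text \<open>\<open>c b\<close> contains its domain idempotent as a factor, so \<open>rel_act\<close>
  applies with it as \<open>\<gamma>\<close>; whenever the concatenation is a word, the transition
  from \<open>b\<close> makes that idempotent fix the first letter of \<open>w\<close>.\<close>

lemma phi_word: assumes W: "v @ [b] \<in> W" shows "phi (act v (c b)) = theta W (v @ [b])"
proof (rule map_eqI)
  fix w w'
  have B: "set v \<subseteq> B" "b \<in> B" using wordD[OF W] by auto
  have eq: "act v (c b) = act (v @ [b]) ((c b)\<^sup>\<star> \<otimes> c b)" using B by (simp add: act_append)
  have "((c b)\<^sup>\<star> \<otimes> c b) \<otimes> c (hd w) = c (hd w)" if "w \<in> W" "(v @ [b]) @ w \<in> W"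
  proof -
    have "w \<noteq> []" "hd w \<in> B" using that lang_iff[OF transition, of w] by auto
    then have "T b (hd w) = 1" using that(2) lang_append[OF transition, of "v @ [b]" w] by simp
    then show ?thesis using letter_U U_letter B(2) \<open>hd w \<in> B\<close> by blast
  qed
  then have "rel (act v (c b)) w w' \<longleftrightarrow> theta W (v @ [b]) w = Some w'"
    unfolding eq theta_Some_iff using rel_act[of "v @ [b]" "(c b)\<^sup>\<star> \<otimes> c b" w w'] B letter_Q by auto
  then show "phi (act v (c b)) w = Some w' \<longleftrightarrow> theta W (v @ [b]) w = Some w'"
    using B by (simp add: phi_Some_iff)
qed

lemma language_word:
  assumes "x \<in> products H (assoc_alphabet H \<O>)"
  shows "\<exists>v b. set v \<subseteq> B \<and> b \<in> B \<and> x = act v (c b)"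
  using assms
proof (induction rule: products.induct)
  case (single x)
  then obtain b where "b \<in> B" "x = c b" by (rule alphabet_letter)
  then show ?case by (intro exI[of _ "[]"] exI[of _ b]) simp
next
  case (step x y)
  obtain a where "a \<in> B" "x = c a" using alphabet_letter[OF step(1)] .
  moreover obtain v b where "set v \<subseteq> B" "b \<in> B" "y = act v (c b)" using step(3) by blast
  ultimately show ?case by (intro exI[of _ "a # v"] exI[of _ b]) simp
qed

lemma phi_language: assumes "x \<in> assoc_language H \<O>" shows "phi x \<in> theta W ` W"
proof -
  obtain v b where "set v \<subseteq> B" "b \<in> B" "x = act v (c b)" "x \<noteq> \<zero>"
    using language_word assms unfolding assoc_language_def by blast
  then have "v @ [b] \<in> W" "phi x = theta W (v @ [b])" using word_iff phi_word by auto
  then show ?thesis by blast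
qed

lemma language_closed: "assoc_language H \<O> \<subseteq> carrier H"
  using alphabet_products_closed by (auto simp: assoc_language_def)

lemma phi_image: "phi ` carrier H = carrier (inverse_hull B T)"
proof
  let ?L = "assoc_language H \<O>" and ?G = "theta W ` W \<union> star (partial_bijections W) ` theta W ` W"
  have L: "?L \<union> star H ` ?L \<subseteq> carrier H" using language_closed by blast
  have gens: "phi x \<in> ?G" if "x \<in> ?L \<union> star H ` ?L" for x
    using that
  proof
    assume "x \<in> star H ` ?L"
    then obtain y where y: "y \<in> ?L" "x = y\<^sup>\<star>" by blast
    then have "phi x = star (partial_bijections W) (phi y)" using phi_star language_closed by blast
    then show ?thesis using phi_language[OF y(1)] by simp
  qed (use phi_language in simp)
  have "phi h \<in> products (partial_bijections W) ?G" if "h \<in> products H (?L \<union> star H ` ?L)" for h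
    using that
  proof (induction rule: products.induct)
    case (single x)
    then show ?case by (intro products.single gens)
  next
    case (step x y)
    then have "phi (x \<otimes> y) = phi x \<otimes>\<^bsub>partial_bijections W\<^esub> phi y"
      using phi_mult L products_closed[OF L] by (simp add: subset_eq)
    moreover have "phi x \<otimes>\<^bsub>partial_bijections W\<^esub> phi y \<in> products (partial_bijections W) ?G"
      by (rule products.step[OF gens[OF step(1)] step(3)])
    ultimately show ?case by simp
  qed
  then show "phi ` carrier H \<subseteq> carrier (inverse_hull B T)"
    using gen phi_zero unfolding generates_def inverse_hull_carrier generated_def by auto
next
  let ?G = "theta W ` W \<union> star (partial_bijections W) ` theta W ` W"
  have theta: "theta W w \<in> phi ` carrier H" if w: "w \<in> W" for w
  proof -
    obtain v b where "w = v @ [b]" using w lang_iff[OF transition] by (metis rev_exhaust)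
    then have "theta W w = phi (act v (c b))" "act v (c b) \<in> carrier H"
      using phi_word[of v b] wordD(1,2)[of v b] w by auto
    then show ?thesis by (rule image_eqI)
  qed
  have gens: "x \<in> phi ` carrier H" if "x \<in> ?G" for x
  proof -
    have "star (partial_bijections W) y \<in> phi ` carrier H" if "y \<in> phi ` carrier H" for y
      using that phi_star[symmetric] by auto
    then show ?thesis using that theta by blast
  qed
  have "x \<in> phi ` carrier H" if "x \<in> products (partial_bijections W) ?G" for x
    using that
  proof (induction rule: products.induct)
    case (step x y)
    then obtain g h where "g \<in> carrier H" "h \<in> carrier H" "x = phi g" "y = phi h" using gens by blast
    then have "x \<otimes>\<^bsub>partial_bijections W\<^esub> y = phi (g \<otimes> h)" "g \<otimes> h \<in> carrier H"
      using phi_mult[of g h] by auto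
    then show ?case by (rule image_eqI)
  qed (rule gens)
  moreover have "Map.empty \<in> phi ` carrier H" using phi_zero by (metis imageI zero_closed)
  ultimately show "carrier (inverse_hull B T) \<subseteq> phi ` carrier H"
    unfolding inverse_hull_carrier generated_def by auto
qed

section \<open>Faithfulness of the action\<close>

lemma Q_above_iff:
  assumes "\<gamma> \<in> Q" "b \<in> B" shows "\<gamma> \<otimes> (c b \<otimes> (c b)\<^sup>\<star>) = c b \<otimes> (c b)\<^sup>\<star> \<longleftrightarrow> \<gamma> \<otimes> c b = c b"
proof
  assume "\<gamma> \<otimes> (c b \<otimes> (c b)\<^sup>\<star>) = c b \<otimes> (c b)\<^sup>\<star>"
  then have "(\<gamma> \<otimes> (c b \<otimes> (c b)\<^sup>\<star>)) \<otimes> c b = (c b \<otimes> (c b)\<^sup>\<star>) \<otimes> c b" by simp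
  then show "\<gamma> \<otimes> c b = c b" using assms by (simp add: mult_assoc)
next
  assume "\<gamma> \<otimes> c b = c b"
  then show "\<gamma> \<otimes> (c b \<otimes> (c b)\<^sup>\<star>) = c b \<otimes> (c b)\<^sup>\<star>" using assms by (simp add: mult_assoc[symmetric])
qed

lemma Q_ex_letter: assumes "\<gamma> \<in> Q" obtains b where "b \<in> B" "\<gamma> \<otimes> c b = c b"
  using Q_above[OF assms] O_letter Q_above_iff[OF assms] by metis

text \<open>\<open>x\<close> sends \<open>[b]\<close> to \<open>t @ [b]\<close>, so going back with
  its inverse and forth again fixes \<open>t @ [b]\<close>. These are the shortest words in the
  domain.\<close>

lemma rel_idem:
  assumes x: "x \<in> carrier H" "x\<^sup>\<star> \<otimes> x \<in> Q" and t: "set t \<subseteq> B" "x = act t (x\<^sup>\<star> \<otimes> x)"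
    and b: "b \<in> B" "(x\<^sup>\<star> \<otimes> x) \<otimes> c b = c b"
  shows "rel (x \<otimes> x\<^sup>\<star>) (t @ [b]) (t @ [b])"
proof -
  have "x \<otimes> c b = act t ((x\<^sup>\<star> \<otimes> x) \<otimes> c b)"
    by (subst t(2)) (rule act_mult[symmetric], use x t b in auto)
  then have "x \<otimes> c b = act t (c b)" using b by simp
  moreover have "x \<otimes> c b \<noteq> \<zero>" using b x letter_nonzero[OF b(1)] by (auto simp: mult_assoc)
  ultimately have "t @ [b] \<in> W" using word_iff t b by auto
  moreover have "[b] \<in> W" using lang_single[OF transition] b by simp
  ultimately have "rel (act t (x\<^sup>\<star> \<otimes> x)) [b] (t @ [b])" using rel_act[OF t(1) x(2)] b by simp
  then have r: "rel x [b] (t @ [b])" using t(2) by simp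
  then show ?thesis using rel_mult[of x "x\<^sup>\<star>"] rel_star[OF r x(1)] x(1) by blast
qed

lemma rel_idemD:
  assumes y: "y \<in> carrier H" "y\<^sup>\<star> \<otimes> y \<in> Q" and s: "set s \<subseteq> B" "y = act s (y\<^sup>\<star> \<otimes> y)"
    and r: "rel (y \<otimes> y\<^sup>\<star>) w w'"
  shows "\<exists>w1. w1 \<noteq> [] \<and> w = s @ w1 \<and> (y\<^sup>\<star> \<otimes> y) \<otimes> c (hd w1) = c (hd w1)"
proof -
  obtain w1 where "rel (y\<^sup>\<star>) w w1" using rel_mult[of y "y\<^sup>\<star>"] y(1) r by blast
  then have "rel y w1 w" using rel_star[of "y\<^sup>\<star>"] y(1) by fastforce
  then have "rel (act s (y\<^sup>\<star> \<otimes> y)) w1 w" using s(2) by simp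
  then show ?thesis using rel_act[OF s(1) y(2)] lang_iff[OF transition] by blast
qed

text \<open>A shortest word of the common domain is a prefix followed by one letter; comparing both
  descriptions gives equal lengths, thus the same prefix and the same letters fixed by the two
  domain idempotents. (O4) identifies these idempotents, hence \<open>x\<close> and
  \<open>y\<close>.\<close>

lemma phi_inj_idems:
  assumes e: "e \<in> idems H" and f: "f \<in> idems H" and eq: "phi e = phi f"
  shows "e = f"
proof -
  have rel: "rel e w w' \<longleftrightarrow> rel f w w'" for w w'
    using eq phi_Some_iff[OF idems_closed[OF e]] phi_Some_iff[OF idems_closed[OF f]] by metis
  have nz: "\<exists>w w'. rel g w w'" if g: "g \<in> idems H" "g \<noteq> \<zero>" for g
  proof -
    obtain x where x: "x \<in> carrier H" "x\<^sup>\<star> \<otimes> x \<in> Q" "g = x \<otimes> x\<^sup>\<star>" using idem_form[OF g] .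
    obtain t where t: "set t \<subseteq> B" "x = act t (x\<^sup>\<star> \<otimes> x)" using Q_domain_form[OF x(1,2)] .
    obtain b where "b \<in> B" "(x\<^sup>\<star> \<otimes> x) \<otimes> c b = c b" using Q_ex_letter[OF x(2)] .
    then show ?thesis using rel_idem[OF x(1,2) t] x(3) by blast
  qed
  have z: "\<not> rel \<zero> w w'" for w w'
    using phi_zero phi_Some_iff[OF zero_closed, of w w'] by simp
  show ?thesis
  proof (cases "e = \<zero> \<or> f = \<zero>")
    case True
    then show ?thesis using nz[OF e] nz[OF f] rel z by metis
  next
    case False
    obtain x where x: "x \<in> carrier H" "x\<^sup>\<star> \<otimes> x \<in> Q" "e = x \<otimes> x\<^sup>\<star>" using idem_form[OF e] False by blast
    obtain t where t: "set t \<subseteq> B" "x = act t (x\<^sup>\<star> \<otimes> x)" using Q_domain_form[OF x(1,2)] .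
    obtain y where y: "y \<in> carrier H" "y\<^sup>\<star> \<otimes> y \<in> Q" "f = y \<otimes> y\<^sup>\<star>" using idem_form[OF f] False by blast
    obtain s where s: "set s \<subseteq> B" "y = act s (y\<^sup>\<star> \<otimes> y)" using Q_domain_form[OF y(1,2)] .
    have 1: "\<exists>w. w \<noteq> [] \<and> t @ [b] = s @ w \<and> (y\<^sup>\<star> \<otimes> y) \<otimes> c (hd w) = c (hd w)"
      if "b \<in> B" "(x\<^sup>\<star> \<otimes> x) \<otimes> c b = c b" for b
      using rel_idem[OF x(1,2) t that] rel_idemD[OF y(1,2) s] rel x(3) y(3) by blast
    have 2: "\<exists>w. w \<noteq> [] \<and> s @ [b] = t @ w \<and> (x\<^sup>\<star> \<otimes> x) \<otimes> c (hd w) = c (hd w)"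
      if "b \<in> B" "(y\<^sup>\<star> \<otimes> y) \<otimes> c b = c b" for b
      using rel_idem[OF y(1,2) s that] rel_idemD[OF x(1,2) t] rel x(3) y(3) by blast
    have prefix: "length q \<le> length p" if "w \<noteq> []" "p @ [b] = q @ w" for p q w and b :: 'b
      using arg_cong[OF that(2), of length] that(1) by (cases w) auto
    have "length s \<le> length t" using Q_ex_letter[OF x(2)] 1 prefix by metis
    moreover have "length t \<le> length s" using Q_ex_letter[OF y(2)] 2 prefix by metis
    ultimately have len: "length s = length t" by simp
    have st: "s = t" using Q_ex_letter[OF x(2)] 1 len by (metis append_eq_append_conv)
    have iff: "(x\<^sup>\<star> \<otimes> x) \<otimes> c b = c b \<longleftrightarrow> (y\<^sup>\<star> \<otimes> y) \<otimes> c b = c b" if "b \<in> B" for b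
      using 1[OF that] 2[OF that] unfolding st by auto
    \<comment> \<open>Every member of \<open>\<O>\<close> is the range of a letter, and
      \<open>Q_above_iff\<close> turns lying above it into fixing that letter, so (O4) becomes
      applicable.\<close>
    have "natural_le H e' (x\<^sup>\<star> \<otimes> x) \<longleftrightarrow> natural_le H e' (y\<^sup>\<star> \<otimes> y)" if e': "e' \<in> \<O>" for e'
    proof -
      obtain b where b: "b \<in> B" "e' = c b \<otimes> (c b)\<^sup>\<star>" using O_letter[OF e'] .
      show ?thesis
        using natural_le_idems[OF O_idem[OF e'] Q_idem[OF x(2)]]
          natural_le_idems[OF O_idem[OF e'] Q_idem[OF y(2)]]
          Q_above_iff[OF x(2) b(1)] Q_above_iff[OF y(2) b(1)] iff[OF b(1)] b(2) by simp
    qed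
    then have "{e' \<in> \<O>. natural_le H e' (x\<^sup>\<star> \<otimes> x)} = {e' \<in> \<O>. natural_le H e' (y\<^sup>\<star> \<otimes> y)}" by blast
    then have "x\<^sup>\<star> \<otimes> x = y\<^sup>\<star> \<otimes> y"
      using conds x(2) y(2) unfolding O_conditions_def O4_def by blast
    then have "x = y" using t(2) s(2) st by metis
    then show ?thesis using x(3) y(3) by simp
  qed
qed

lemma phi_inj: "inj_on phi (carrier H)"
proof (rule inj_onI)
  fix g h assume gh: "g \<in> carrier H" "h \<in> carrier H" and eq: "phi g = phi h"
  have "phi (g\<^sup>\<star> \<otimes> g) = phi (h\<^sup>\<star> \<otimes> h)" "phi (g \<otimes> g\<^sup>\<star>) = phi (h \<otimes> h\<^sup>\<star>)"
    using gh eq by (simp_all add: phi_mult phi_star)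
  then have "g\<^sup>\<star> \<otimes> g = h\<^sup>\<star> \<otimes> h" "g \<otimes> g\<^sup>\<star> = h \<otimes> h\<^sup>\<star>" using phi_inj_idems gh by auto
  then have "green_H H g h" by (simp add: green_H_def green_L_def green_R_def)
  then show "g = h" using comb gh unfolding combinatorial_def by blast
qed

lemma isomorphic_inverse_hull: "isomorphic H (inverse_hull B T)"
  unfolding isomorphic_def
  using phi_inj phi_image phi_mult by (intro exI[of _ phi]) (auto simp: bij_betw_def)

end


lemma isomorphic_inverse_hullD:
  assumes H: "inverse_semigroup_zero H" and T: "transition_matrix B T"
    and iso: "isomorphic H (inverse_hull B T)"
  shows "combinatorial H \<and> (\<exists>\<O>. O_conditions H \<O> \<and> (finite B \<longrightarrow> finite (assoc_alphabet H \<O>)) \<and>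
    generates H (assoc_language H \<O>))"
proof -
  interpret M: markov_hull B T by (unfold_locales) (rule T)
  interpret H: inverse_semigroup_zero H by (rule H)
  obtain \<phi> where \<phi>: "bij_betw \<phi> (carrier H) (carrier M.G)"
    "\<And>x y. \<lbrakk>x \<in> carrier H; y \<in> carrier H\<rbrakk> \<Longrightarrow> \<phi> (x \<otimes>\<^bsub>H\<^esub> y) = \<phi> x \<otimes>\<^bsub>M.G\<^esub> \<phi> y"
    using iso unfolding isomorphic_def by blast
  \<comment> \<open>The conditions were verified in the hull, so they are carried along the inverse
    of the given map.\<close>
  define \<psi> where "\<psi> = inv_into (carrier H) \<phi>"
  have \<psi>: "bij_betw \<psi> (carrier M.G) (carrier H)"
    unfolding \<psi>_def by (rule bij_betw_inv_into[OF \<phi>(1)])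
  have \<phi>\<psi>: "\<phi> (\<psi> y) = y" "\<psi> y \<in> carrier H" if "y \<in> carrier M.G" for y
    using bij_betw_inv_into_right[OF \<phi>(1) that] \<psi> that by (auto simp: \<psi>_def bij_betw_def)
  have hom: "\<psi> (x \<otimes>\<^bsub>M.G\<^esub> y) = \<psi> x \<otimes>\<^bsub>H\<^esub> \<psi> y" if x: "x \<in> carrier M.G" and y: "y \<in> carrier M.G" for x y
  proof -
    have "\<phi> (\<psi> x \<otimes>\<^bsub>H\<^esub> \<psi> y) = x \<otimes>\<^bsub>M.G\<^esub> y" using \<phi>(2) \<phi>\<psi>[OF x] \<phi>\<psi>[OF y] by metis
    then show ?thesis
      using bij_betw_inv_into_left[OF \<phi>(1) H.mult_closed[OF \<phi>\<psi>(2)[OF x] \<phi>\<psi>(2)[OF y]]]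
      unfolding \<psi>_def by metis
  qed
  interpret I: inverse_semigroup_iso M.G H \<psi>
    by unfold_locales (use \<psi> hom in auto)
  have O: "M.hull_O \<subseteq> carrier M.G" using M.q_idem M.G.idems_closed by blast
  have "finite B \<Longrightarrow> finite (assoc_alphabet H (\<psi> ` M.hull_O))"
    by (simp add: I.assoc_alphabet_image[OF O] M.hull_alphabet)
  then show ?thesis
    using I.combinatorial_image[OF M.hull_combinatorial] I.O_conditions_image[OF M.hull_O_conditions]
      I.generates_image[OF O M.hull_generates] by blast
qed

lemma isomorphic_inverse_hullI:
  assumes "inverse_semigroup_zero H" "combinatorial H" "O_conditions H \<O>"
    "generates H (assoc_language H \<O>)" "bij_betw c B (assoc_alphabet H \<O>)"
  shows "\<exists>T. transition_matrix B T \<and> isomorphic H (inverse_hull B T)"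
proof -
  interpret markov_semigroup H \<O> B c
    using assms by (intro markov_semigroup.intro markov_semigroup_axioms.intro)
  show ?thesis using transition isomorphic_inverse_hull by blast
qed


theorem theorem4p10:
  fixes H :: "'a zero_semigroup"
  assumes "inverse_semigroup_zero H"
  shows "((\<exists>(B :: nat set) T. finite B \<and> transition_matrix B T \<and> isomorphic H (inverse_hull B T))
            \<longleftrightarrow> combinatorial H \<and>
                (\<exists>\<O>. O_conditions H \<O> \<and> finite (assoc_alphabet H \<O>) \<and>
                      generates H (assoc_language H \<O>)))
       \<and> ((\<exists>(B :: 'a set) T. transition_matrix B T \<and> isomorphic H (inverse_hull B T))
            \<longleftrightarrow> combinatorial H \<and>
                (\<exists>\<O>. O_conditions H \<O> \<and> generates H (assoc_language H \<O>)))"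
proof (intro conjI iffI)
  assume "\<exists>(B :: nat set) T. finite B \<and> transition_matrix B T \<and> isomorphic H (inverse_hull B T)"
  then show "combinatorial H" and "\<exists>\<O>. O_conditions H \<O> \<and> finite (assoc_alphabet H \<O>) \<and>
      generates H (assoc_language H \<O>)"
    using isomorphic_inverse_hullD[OF assms] by blast+
next
  assume *: "combinatorial H \<and> (\<exists>\<O>. O_conditions H \<O> \<and> finite (assoc_alphabet H \<O>) \<and>
    generates H (assoc_language H \<O>))"
  then obtain \<O> where \<O>: "O_conditions H \<O>" "finite (assoc_alphabet H \<O>)"
    "generates H (assoc_language H \<O>)" by blast
  obtain c where "bij_betw c {0..<card (assoc_alphabet H \<O>)} (assoc_alphabet H \<O>)"
    using ex_bij_betw_nat_finite[OF \<O>(2)] by blast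
  then show "\<exists>(B :: nat set) T. finite B \<and> transition_matrix B T \<and> isomorphic H (inverse_hull B T)"
    using isomorphic_inverse_hullI[OF assms] * \<O> by (meson finite_atLeastLessThan)
next
  assume "\<exists>(B :: 'a set) T. transition_matrix B T \<and> isomorphic H (inverse_hull B T)"
  then show "combinatorial H" and "\<exists>\<O>. O_conditions H \<O> \<and> generates H (assoc_language H \<O>)"
    using isomorphic_inverse_hullD[OF assms] by blast+
next
  assume "combinatorial H \<and> (\<exists>\<O>. O_conditions H \<O> \<and> generates H (assoc_language H \<O>))"
  \<comment> \<open>Here \<open>B\<close> is the alphabet of \<open>H\<close> itself, with the
    identity as \<open>c\<close>.\<close>
  then show "\<exists>(B :: 'a set) T. transition_matrix B T \<and> isomorphic H (inverse_hull B T)"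
    using isomorphic_inverse_hullI[OF assms] bij_betw_id by meson
qed

end
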